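(* Let $\mathcal{G}$ be the infinite Ginibre ensemble on $\mathbb{C}$ and let $\mathcal{D}\subset\mathbb{C}$ be a bounded open set. Then there is a measurable function $N:\mathcal{S}_{\mathrm{out}}\to\mathbb{N}\cup\{0\}$ such that almost surely $$\text{(number of points in } \mathcal{G}_{\mathrm{in}})=N(\mathcal{G}_{\mathrm{out}}).$$
   Context: The infinite Ginibre ensemble $\mathcal{G}$ is the determinantal point process on $\mathbb{C}$ with kernel $K(z,w)=\sum_{j\ge 0}\frac{(z\overline{w})^j}{j!}=e^{z\overline{w}}$ with respect to the background measure $\frac1\pi e^{-|z|^2}\,d\mathcal{L}(z)$, where $\mathcal{L}$ is Lebesgue measure on $\mathbb{C}$; i.e. its $k$-point intensity functions with respect to that background measure are $\det[K(x_i,x_j)]_{i,j=1}^k$. $\mathcal{S}$ is the Polish space of locally finite point configurations on $\mathbb{C}$ (topology of weak convergence of the associated counting measures). For the bounded open set $\mathcal{D}$, $\mathcal{S}=\mathcal{S}_{\mathrm{in}}\times\mathcal{S}_{\mathrm{out}}$, where $\mathcal{S}_{\mathrm{in}}$ is the space of finite point configurations on $\mathcal{D}$ and $\mathcal{S}_{\mathrm{out}}$ is the space of locally finite point configurations on $\mathcal{D}^c$. For a point process $\Pi$, $\Pi_{\mathrm{in}}$ and $\Pi_{\mathrm{out}}$ denote its restrictions to $\mathcal{D}$ and $\mathcal{D}^c$. *)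

theory Defs
  imports "HOL-Probability.Probability" "Jordan_Normal_Form.Determinant"
begin

text \<open>
  A point configuration on \<^term>\<open>E\<close> is a subset of \<^term>\<open>E\<close>, identified with its counting measure
  \<^term>\<open>count_space \<xi>\<close>. Local finiteness and test functions are taken relative to
  \<^term>\<open>E\<close>, which is meant to be a locally compact subset of the plane; below it is the whole
  plane or the closed complement of an open set.
\<close>

definition configurations :: "complex set \<Rightarrow> complex set set" where
  "configurations E = {\<xi>. \<xi> \<subseteq> E \<and> (\<forall>C. compact C \<and> C \<subseteq> E \<longrightarrow> finite (\<xi> \<inter> C))}"

definition test_functions :: "complex set \<Rightarrow> (complex \<Rightarrow> real) set" where
  "test_functions E =
     {f. continuous_on E f \<and> (\<exists>C. compact C \<and> C \<subseteq> E \<and> (\<forall>x\<in>E - C. f x = 0))}"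

text \<open>
  The coarsest topology for which \<open>\<xi> \<mapsto> \<Sum>x\<in>\<xi>. f x\<close> is continuous for every test function \<open>f\<close>: for
  locally finite counting measures, weak convergence means convergence of these integrals.
\<close>

definition configuration_topology :: "complex set \<Rightarrow> complex set topology" where
  "configuration_topology E = topology_generated_by
     {{\<xi> \<in> configurations E. (\<integral>x. f x \<partial>count_space \<xi>) \<in> U} | f U.
        f \<in> test_functions E \<and> open U}"

definition configuration_space :: "complex set \<Rightarrow> complex set measure" where
  "configuration_space E =
     sigma (configurations E) {U. openin (configuration_topology E) U}"

definition point_process :: "'a measure \<Rightarrow> ('a \<Rightarrow> complex set) \<Rightarrow> bool" where
  "point_process M X \<longleftrightarrow> prob_space M \<and> X \<in> M \<rightarrow>\<^sub>M configuration_space UNIV"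

text \<open>
  \<^term>\<open>\<rho>\<close> is the density, with respect to the \<^term>\<open>k\<close>-fold product of \<^term>\<open>\<mu>\<close>, of the
  expected counting measure of ordered \<^term>\<open>k\<close>-tuples of pairwise distinct points. A tuple is a
  function on \<^term>\<open>{..<k}\<close> that is \<^term>\<open>undefined\<close> elsewhere, as in \<^term>\<open>PiM\<close>.
\<close>

definition k_point_intensity ::
    "'a measure \<Rightarrow> ('a \<Rightarrow> complex set) \<Rightarrow> complex measure \<Rightarrow> nat \<Rightarrow>
     ((nat \<Rightarrow> complex) \<Rightarrow> real) \<Rightarrow> bool" where
  "k_point_intensity M X \<mu> k \<rho> \<longleftrightarrow>
     \<rho> \<in> borel_measurable (\<Pi>\<^sub>M i\<in>{..<k}. \<mu>) \<and> (\<forall>x. 0 \<le> \<rho> x) \<and>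
     (\<forall>f :: (nat \<Rightarrow> complex) \<Rightarrow> ennreal. f \<in> borel_measurable (\<Pi>\<^sub>M i\<in>{..<k}. \<mu>) \<longrightarrow>
        (\<integral>\<^sup>+\<omega>. (\<integral>\<^sup>+x. f x \<partial>count_space {x \<in> {..<k} \<rightarrow>\<^sub>E X \<omega>. inj_on x {..<k}}) \<partial>M) =
        (\<integral>\<^sup>+x. f x * ennreal (\<rho> x) \<partial>(\<Pi>\<^sub>M i\<in>{..<k}. \<mu>)))"

definition determinantal_point_process ::
    "'a measure \<Rightarrow> ('a \<Rightarrow> complex set) \<Rightarrow> (complex \<Rightarrow> complex \<Rightarrow> complex) \<Rightarrow>
     complex measure \<Rightarrow> bool" where
  "determinantal_point_process M X K \<mu> \<longleftrightarrow>
     point_process M X \<and>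
     (\<forall>k\<ge>1. \<exists>\<rho>. k_point_intensity M X \<mu> k \<rho> \<and>
        (\<forall>x. complex_of_real (\<rho> x) = Determinant.det (Matrix.mat k k (\<lambda>(i, j). K (x i) (x j)))))"

definition ginibre_kernel :: "complex \<Rightarrow> complex \<Rightarrow> complex" where
  "ginibre_kernel z w = exp (z * cnj w)"

definition ginibre_background :: "complex measure" where
  "ginibre_background = density lborel (\<lambda>z. ennreal (exp (- (cmod z)\<^sup>2) / pi))"

definition infinite_ginibre_ensemble :: "'a measure \<Rightarrow> ('a \<Rightarrow> complex set) \<Rightarrow> bool" where
  "infinite_ginibre_ensemble M G \<longleftrightarrow>
     determinantal_point_process M G ginibre_kernel ginibre_background"

end

theory Submission
  imports Defs
begin

text \<open>
  For a function \<open>\<phi>\<close> on the plane let \<open>S \<phi>\<close> be the sum of \<open>\<phi>\<close> over the points of the process. The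
  one- and two-point intensities and the reproducing property of the kernel give
  \<open>Var (S \<phi>) = 1 / (2 \<pi>\<^sup>2) \<integral>\<integral> (\<phi> y - \<phi> z)\<^sup>2 exp (- |z - y|\<^sup>2) dz dy\<close>, which is controlled by the Dirichlet
  energy of \<open>\<phi>\<close>. In the plane, logarithmic cutoffs are compactly supported, equal to 1 on a given
  disc, and have arbitrarily small energy. Choosing cutoffs \<open>\<phi>\<^sub>j\<close> equal to 1 on \<open>D\<close> with summable
  variances, \<open>S \<phi>\<^sub>j\<close> minus its mean tends to 0 almost surely. Since \<open>S \<phi>\<^sub>j\<close> is the number of points
  in \<open>D\<close> plus a statistic of the configuration outside \<open>D\<close>, that number is the limit of the mean of
  \<open>S \<phi>\<^sub>j\<close> minus the outside statistic.
\<close>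

section \<open>Gaussian integrals\<close>

text \<open>The integrand is \<open>sqrt (pi / a)\<close> times the normal density of mean 0 and
  variance \<open>1 / (2 * a)\<close>, whose total mass is 1.\<close>

lemma nn_integral_gaussian_real:
  assumes "a > 0"
  shows "(\<integral>\<^sup>+x. ennreal (exp (- (a * x\<^sup>2))) \<partial>lborel) = ennreal (sqrt (pi / a))"
proof -
  define \<sigma> where "\<sigma> = sqrt (1 / (2 * a))"
  have \<sigma>: "\<sigma> > 0" "\<sigma>\<^sup>2 = 1 / (2 * a)"
    using assms by (auto simp: \<sigma>_def)
  have eq: "exp (- (a * x\<^sup>2)) = sqrt (pi / a) * normal_density 0 \<sigma> x" for x
    using assms by (simp add: normal_density_def \<sigma> real_sqrt_divide field_simps)
  interpret prob_space "density lborel (normal_density 0 \<sigma>)"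
    using \<sigma>(1) by (rule prob_space_normal_density)
  have "(\<integral>\<^sup>+x. ennreal (normal_density 0 \<sigma> x) \<partial>lborel) = 1"
    using emeasure_space_1 by (simp add: emeasure_density)
  then show ?thesis
    using assms by (simp add: eq ennreal_mult' nn_integral_cmult)
qed

text \<open>Since |z|^2 is the sum of the squares of the real and imaginary parts, the integral
  factors into two equal real Gaussian integrals.\<close>

lemma nn_integral_gaussian_complex:
  assumes "a > 0"
  shows "(\<integral>\<^sup>+z. ennreal (exp (- (a * (cmod z)\<^sup>2))) \<partial>lborel) = ennreal (pi / a)"
proof -
  have "(\<integral>\<^sup>+z. ennreal (exp (- (a * (cmod z)\<^sup>2))) \<partial>lborel) =
        (\<integral>\<^sup>+z. (\<Prod>b\<in>Basis. ennreal (exp (- (a * (inner (z::complex) b)\<^sup>2)))) \<partial>lborel)"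
  proof (intro nn_integral_cong)
    fix z :: complex
    have "exp (- (a * (cmod z)\<^sup>2)) = exp (- (a * (Re z)\<^sup>2)) * exp (- (a * (Im z)\<^sup>2))"
      by (simp add: cmod_power2 ring_distribs flip: exp_add)
    then show "ennreal (exp (- (a * (cmod z)\<^sup>2))) = (\<Prod>b\<in>Basis. ennreal (exp (- (a * (inner z b)\<^sup>2))))"
      by (simp add: Basis_complex_def ennreal_mult' inner_complex_def)
  qed
  also have "\<dots> = (\<Prod>b\<in>(Basis :: complex set). \<integral>\<^sup>+x. ennreal (exp (- (a * x\<^sup>2))) \<partial>lborel)"
    by (rule nn_integral_lborel_prod) auto
  also have "\<dots> = ennreal (pi / a)"
    using assms by (simp add: nn_integral_gaussian_real Basis_complex_def flip: ennreal_mult')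
  finally show ?thesis .
qed

lemma nn_integral_lborel_translate:
  fixes c :: "'a::euclidean_space"
  assumes "f \<in> borel_measurable borel"
  shows "(\<integral>\<^sup>+y. f (y - c) \<partial>lborel) = (\<integral>\<^sup>+y. f y \<partial>lborel)"
proof -
  have "(\<integral>\<^sup>+y. f y \<partial>lborel) = (\<integral>\<^sup>+y. f y \<partial>distr lborel borel ((+) (- c)))"
    by (simp only: lborel_distr_plus)
  also have "\<dots> = (\<integral>\<^sup>+y. f (y - c) \<partial>lborel)"
    using assms by (subst nn_integral_distr) auto
  finally show ?thesis ..
qed

lemma nn_integral_exp_translate:
  "(\<integral>\<^sup>+z. ennreal (exp (- (cmod (z - y))\<^sup>2)) \<partial>lborel) = ennreal pi"
  using nn_integral_gaussian_complex[of 1]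
    nn_integral_lborel_translate[of "\<lambda>z. ennreal (exp (- (cmod z)\<^sup>2))" y] by simp

text \<open>After translation to \<open>y = 0\<close>, the inequality
  \<open>t * exp (- t) \<le> exp (- (t / 2))\<close> with t = |z|^2 reduces the moment to a wider
  Gaussian. What matters later is that the bound is uniform in \<open>y\<close>.\<close>

lemma nn_integral_gaussian_moment_le:
  "(\<integral>\<^sup>+z. ennreal ((cmod (z - y))\<^sup>2 * exp (- (cmod (z - y))\<^sup>2)) \<partial>lborel) \<le> ennreal (2 * pi)"
proof -
  have "(\<integral>\<^sup>+z. ennreal ((cmod (z - y))\<^sup>2 * exp (- (cmod (z - y))\<^sup>2)) \<partial>lborel) =
      (\<integral>\<^sup>+z. ennreal ((cmod z)\<^sup>2 * exp (- (cmod z)\<^sup>2)) \<partial>lborel)"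
    by (rule nn_integral_lborel_translate[where f = "\<lambda>z. ennreal ((cmod z)\<^sup>2 * exp (- (cmod z)\<^sup>2))"]) measurable
  also have "\<dots> \<le> (\<integral>\<^sup>+z. ennreal (exp (- (1 / 2 * (cmod z)\<^sup>2))) \<partial>lborel)"
  proof (intro nn_integral_mono ennreal_leI)
    fix z :: complex
    define t where "t = (cmod z)\<^sup>2"
    \<comment> \<open>This square shows that \<open>t\<close> lies below the quadratic Taylor
      polynomial of \<open>exp (t / 2)\<close>.\<close>
    have "0 \<le> (t / 2 - 1)\<^sup>2"
      by simp
    then have "t \<le> 1 + t / 2 + (t / 2)\<^sup>2 / 2"
      by (simp add: power2_eq_square algebra_simps)
    also have "\<dots> \<le> exp (t / 2)"
      by (rule exp_lower_Taylor_quadratic) (simp add: t_def)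
    finally have "t * exp (- t) \<le> exp (t / 2) * exp (- t)"
      by (intro mult_right_mono) simp_all
    also have "\<dots> = exp (- (1 / 2 * t))"
      by (simp flip: exp_add)
    finally show "(cmod z)\<^sup>2 * exp (- (cmod z)\<^sup>2) \<le> exp (- (1 / 2 * (cmod z)\<^sup>2))"
      by (simp add: t_def)
  qed
  also have "\<dots> = ennreal (2 * pi)"
    using nn_integral_gaussian_complex[of "1 / 2"] by (simp add: mult.commute)
  finally show ?thesis .
qed

section \<open>Linear statistics of configurations\<close>

lemma space_configuration_space [simp]: "space (configuration_space E) = configurations E"
  by (simp add: configuration_space_def space_measure_of_conv)

text \<open>The preimage of an open set is by definition one of the generators of the topology,
  hence one of the generating sets of the sigma-algebra.\<close>

lemma borel_measurable_linear_statistic: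
  assumes "f \<in> test_functions E"
  shows "(\<lambda>\<xi>. \<integral>x. f x \<partial>count_space \<xi>) \<in> borel_measurable (configuration_space E)"
proof (rule borel_measurableI)
  fix U :: "real set"
  assume "open U"
  \<comment> \<open>A measure built by \<open>sigma\<close> has the generated sigma-algebra only if
    its generators are subsets of the given space.\<close>
  have sub: "{U. openin (configuration_topology E) U} \<subseteq> Pow (configurations E)"
  proof -
    have "topspace (configuration_topology E) \<subseteq> configurations E"
      by (auto simp: configuration_topology_def)
    then show ?thesis
      using openin_subset by fastforce
  qed
  have "{\<xi> \<in> configurations E. (\<integral>x. f x \<partial>count_space \<xi>) \<in> U} \<in> {U. openin (configuration_topology E) U}"
    unfolding configuration_topology_def mem_Collect_eq
    using assms \<open>open U\<close> by (intro topology_generated_by_Basis) auto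
  moreover have "(\<lambda>\<xi>. \<integral>x. f x \<partial>count_space \<xi>) -` U \<inter> space (configuration_space E) =
      {\<xi> \<in> configurations E. (\<integral>x. f x \<partial>count_space \<xi>) \<in> U}"
    by auto
  ultimately show "(\<lambda>\<xi>. \<integral>x. f x \<partial>count_space \<xi>) -` U \<inter> space (configuration_space E)
      \<in> sets (configuration_space E)"
    unfolding configuration_space_def by (simp add: sets_measure_of[OF sub])
qed

lemma integral_count_space_compact_support:
  fixes f :: "'a \<Rightarrow> 'b::{banach, second_countable_topology}"
  assumes "finite (X \<inter> C)" "\<And>x. x \<notin> C \<Longrightarrow> f x = 0"
  shows "(\<integral>x. f x \<partial>count_space X) = (\<Sum>x\<in>X \<inter> C. f x)"
proof -
  have sub: "{x \<in> X. f x \<noteq> 0} \<subseteq> X \<inter> C"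
    using assms(2) by auto
  have "(\<integral>x. f x \<partial>count_space X) = (\<Sum>x | x \<in> X \<and> f x \<noteq> 0. f x)"
    by (rule lebesgue_integral_count_space_finite_support) (rule finite_subset[OF sub assms(1)])
  also have "\<dots> = (\<Sum>x\<in>X \<inter> C. f x)"
    using sub assms(1) by (intro sum.mono_neutral_left) auto
  finally show ?thesis .
qed

lemma test_functions_UNIV:
  assumes "continuous_on UNIV f" "\<And>z. z \<notin> cball 0 R \<Longrightarrow> f z = 0"
  shows "f \<in> test_functions UNIV"
  unfolding test_functions_def using assms by (auto intro!: exI[of _ "cball 0 R"])

text \<open>Closedness of \<open>E\<close> keeps the trace \<open>C \<inter> E\<close> of a compact
  support compact. With \<open>E = - D\<close> this makes a cutoff on the plane a test function for
  the outside configuration.\<close>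

lemma test_functions_subset:
  assumes "f \<in> test_functions UNIV" "closed E"
  shows "f \<in> test_functions E"
proof -
  obtain C where C: "compact C" "\<forall>x\<in>UNIV - C. f x = 0" and f: "continuous_on UNIV f"
    using assms(1) by (auto simp: test_functions_def)
  have "compact (C \<inter> E)"
    using C(1) assms(2) by (rule compact_Int_closed)
  moreover have "\<forall>x\<in>E - C \<inter> E. f x = 0"
    using C(2) by blast
  moreover have "continuous_on E f"
    using f by (rule continuous_on_subset) simp
  ultimately show ?thesis
    unfolding test_functions_def by blast
qed

text \<open>Links the real-valued statistics, whose measurability comes from the topology, with the
  nonnegative integrals in which the intensities are expressed.\<close>

lemma nn_integral_count_space_compact_support:
  fixes f :: "'a \<Rightarrow> real"
  assumes "finite (X \<inter> C)" "\<And>x. x \<notin> C \<Longrightarrow> f x = 0" "\<And>x. 0 \<le> f x"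
  shows "(\<integral>\<^sup>+x. ennreal (f x) \<partial>count_space X) = ennreal (\<integral>x. f x \<partial>count_space X)"
proof -
  have "(\<integral>\<^sup>+x. ennreal (f x) \<partial>count_space X) = (\<Sum>x\<in>X \<inter> C. ennreal (f x))"
    using assms(2) by (intro nn_integral_count_space' assms(1)) simp_all
  also have "\<dots> = ennreal (\<integral>x. f x \<partial>count_space X)"
    using assms(3) by (simp add: integral_count_space_compact_support[OF assms(1,2)])
  finally show ?thesis .
qed

text \<open>The square is a double sum over points. Its diagonal is governed by the one-point
  intensity and its off-diagonal part by the two-point intensity.\<close>

lemma square_linear_statistic:
  fixes f :: "'a \<Rightarrow> real"
  assumes fin: "finite (X \<inter> C)" and supp: "\<And>x. x \<notin> C \<Longrightarrow> f x = 0" and nonneg: "\<And>x. 0 \<le> f x"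
  shows "ennreal ((\<integral>x. f x \<partial>count_space X)\<^sup>2) =
     (\<integral>\<^sup>+x. ennreal ((f x)\<^sup>2) \<partial>count_space X) +
     (\<integral>\<^sup>+p. ennreal (f (fst p) * f (snd p)) \<partial>count_space {(y, z). y \<in> X \<and> z \<in> X \<and> y \<noteq> z})"
proof -
  define A where "A = X \<inter> C"
  define P where "P = A \<times> A - Id"
  have fin: "finite A" "finite P"
    using fin by (simp_all add: A_def P_def)
  have "(\<integral>x. f x \<partial>count_space X)\<^sup>2 = (\<Sum>x\<in>A. f x)\<^sup>2"
    using fin supp unfolding A_def by (subst integral_count_space_compact_support[of X C]) auto
  also have "\<dots> = (\<Sum>p\<in>A \<times> A. f (fst p) * f (snd p))"
    by (simp only: power2_eq_square sum_product sum.cartesian_product case_prod_unfold)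
  also have "A \<times> A = (\<lambda>x. (x, x)) ` A \<union> P"
    unfolding P_def by blast
  also have "(\<Sum>p\<in>(\<lambda>x. (x, x)) ` A \<union> P. f (fst p) * f (snd p)) =
      (\<Sum>p\<in>(\<lambda>x. (x, x)) ` A. f (fst p) * f (snd p)) + (\<Sum>p\<in>P. f (fst p) * f (snd p))"
  proof (rule sum.union_disjoint)
    show "(\<lambda>x. (x, x)) ` A \<inter> P = {}"
      unfolding P_def by blast
  qed (simp_all add: fin)
  also have "(\<Sum>p\<in>(\<lambda>x. (x, x)) ` A. f (fst p) * f (snd p)) = (\<Sum>x\<in>A. (f x)\<^sup>2)"
    by (subst sum.reindex) (simp_all add: inj_on_def power2_eq_square)
  finally have "ennreal ((\<integral>x. f x \<partial>count_space X)\<^sup>2) =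
      (\<Sum>x\<in>A. ennreal ((f x)\<^sup>2)) + (\<Sum>p\<in>P. ennreal (f (fst p) * f (snd p)))"
    using nonneg by (simp add: sum_nonneg)
  also have "(\<Sum>x\<in>A. ennreal ((f x)\<^sup>2)) = (\<integral>\<^sup>+x. ennreal ((f x)\<^sup>2) \<partial>count_space X)"
    using supp by (intro nn_integral_count_space'[symmetric] fin) (simp_all add: A_def)
  also have "(\<Sum>p\<in>P. ennreal (f (fst p) * f (snd p))) =
     (\<integral>\<^sup>+p. ennreal (f (fst p) * f (snd p)) \<partial>count_space {(y, z). y \<in> X \<and> z \<in> X \<and> y \<noteq> z})"
  proof (intro nn_integral_count_space'[symmetric] fin)
    fix p assume "p \<in> {(y, z). y \<in> X \<and> z \<in> X \<and> y \<noteq> z}" "p \<notin> P"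
    then have "fst p \<notin> C \<or> snd p \<notin> C"
      by (cases p) (auto simp: P_def A_def)
    then have "f (fst p) * f (snd p) = 0"
      using supp by (metis mult_eq_0_iff)
    then show "ennreal (f (fst p) * f (snd p)) = 0"
      by (simp only: ennreal_0)
  next
    show "P \<subseteq> {(y, z). y \<in> X \<and> z \<in> X \<and> y \<noteq> z}"
      unfolding P_def A_def by blast
  qed
  finally show ?thesis .
qed

text \<open>A function equal to 1 on \<open>D\<close> counts the points there, so all other
  information in the statistic sits in the configuration outside \<open>D\<close>.\<close>

lemma linear_statistic_split:
  assumes "finite (X \<inter> C)" "\<And>x. x \<notin> C \<Longrightarrow> f x = 0" "D \<subseteq> C" "\<And>x. x \<in> D \<Longrightarrow> f x = (1::real)"
  shows "(\<integral>x. f x \<partial>count_space X) = real (card (X \<inter> D)) + (\<integral>x. f x \<partial>count_space (X \<inter> - D))"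
proof -
  have fin: "finite (X \<inter> - D \<inter> C)" "finite (X \<inter> D)"
    using assms(1,3) by (auto elim: rev_finite_subset)
  have "(\<integral>x. f x \<partial>count_space X) = (\<Sum>x\<in>X \<inter> C. f x)"
    by (rule integral_count_space_compact_support[OF assms(1,2)])
  also have "X \<inter> C = (X \<inter> D) \<union> (X \<inter> - D \<inter> C)"
    using assms(3) by blast
  also have "(\<Sum>x\<in>(X \<inter> D) \<union> (X \<inter> - D \<inter> C). f x) = (\<Sum>x\<in>X \<inter> D. f x) + (\<Sum>x\<in>X \<inter> - D \<inter> C. f x)"
    using fin by (intro sum.union_disjoint) auto
  also have "(\<Sum>x\<in>X \<inter> D. f x) = real (card (X \<inter> D))"
    using assms(4) by simp
  also have "(\<Sum>x\<in>X \<inter> - D \<inter> C. f x) = (\<integral>x. f x \<partial>count_space (X \<inter> - D))"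
    by (rule integral_count_space_compact_support[OF fin(1) assms(2), symmetric])
  finally show ?thesis .
qed

section \<open>Intensities of the Ginibre ensemble\<close>

text \<open>Intensities are stated for extensional functions on \<open>{..<k}\<close>. For
  \<open>k = 1\<close>, evaluation at 0 identifies them with points; the value
  \<open>undefined\<close> off the index set makes this a bijection.\<close>

lemma nn_integral_count_space_tuple_1:
  "(\<integral>\<^sup>+x. F (x 0) \<partial>count_space {x \<in> {..<1::nat} \<rightarrow>\<^sub>E X. inj_on x {..<1}}) =
   (\<integral>\<^sup>+z. F z \<partial>count_space X)"
proof -
  have "bij_betw (\<lambda>x. x 0) {x \<in> {..<1::nat} \<rightarrow>\<^sub>E X. inj_on x {..<1}} X"
  proof (rule bij_betw_byWitness[where f' = "\<lambda>z. \<lambda>i\<in>{..<1}. z"])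
    show "\<forall>x\<in>{x \<in> {..<1::nat} \<rightarrow>\<^sub>E X. inj_on x {..<1}}. (\<lambda>i\<in>{..<1}. x 0) = x"
    proof (intro ballI ext)
      fix x and i :: nat
      assume x: "x \<in> {x \<in> {..<1::nat} \<rightarrow>\<^sub>E X. inj_on x {..<1}}"
      show "(\<lambda>i\<in>{..<1}. x 0) i = x i"
      proof (cases "i = 0")
        case False
        then have "x i = undefined"
          using x by (intro PiE_arb[of x "{..<1}" "\<lambda>_. X"]) simp_all
        with False show ?thesis
          by simp
      qed simp
    qed
    show "(\<lambda>x. x 0) ` {x \<in> {..<1::nat} \<rightarrow>\<^sub>E X. inj_on x {..<1}} \<subseteq> X"
      by fastforce
    show "(\<lambda>z. \<lambda>i\<in>{..<1::nat}. z) ` X \<subseteq> {x \<in> {..<1} \<rightarrow>\<^sub>E X. inj_on x {..<1}}"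
      by (simp add: image_subset_iff inj_on_def)
  qed simp
  then show ?thesis
    by (rule nn_integral_bij_count_space)
qed

text \<open>Evaluation at 0 and 1 is a bijection from tuples to ordered pairs, and injectivity on
  \<open>{..<2}\<close> becomes distinctness of the two entries.\<close>

lemma nn_integral_count_space_tuple_2:
  "(\<integral>\<^sup>+x. F (x 0) (x 1) \<partial>count_space {x \<in> {..<2::nat} \<rightarrow>\<^sub>E X. inj_on x {..<2}}) =
   (\<integral>\<^sup>+p. F (fst p) (snd p) \<partial>count_space {(y, z). y \<in> X \<and> z \<in> X \<and> y \<noteq> z})"
proof -
  have "bij_betw (\<lambda>x. (x 0, x 1)) {x \<in> {..<2::nat} \<rightarrow>\<^sub>E X. inj_on x {..<2}}
          {(y, z). y \<in> X \<and> z \<in> X \<and> y \<noteq> z}"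
  proof (rule bij_betw_byWitness[where f' = "\<lambda>(y, z). \<lambda>i\<in>{..<2}. if i = 0 then y else z"])
    show "\<forall>x\<in>{x \<in> {..<2::nat} \<rightarrow>\<^sub>E X. inj_on x {..<2}}.
        (case (x 0, x 1) of (y, z) \<Rightarrow> \<lambda>i\<in>{..<2}. if i = 0 then y else z) = x"
    proof (intro ballI ext)
      fix x and i :: nat
      assume x: "x \<in> {x \<in> {..<2::nat} \<rightarrow>\<^sub>E X. inj_on x {..<2}}"
      consider "i = 0" | "i = 1" | "i \<notin> {..<2}"
        by fastforce
      then show "(case (x 0, x 1) of (y, z) \<Rightarrow> \<lambda>i\<in>{..<2}. if i = 0 then y else z) i = x i"
      proof cases
        case 3
        then have "x i = undefined"
          using x by (intro PiE_arb[of x "{..<2}" "\<lambda>_. X"]) blast+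
        with 3 show ?thesis
          by simp
      qed simp_all
    qed
    show "(\<lambda>x. (x 0, x 1)) ` {x \<in> {..<2::nat} \<rightarrow>\<^sub>E X. inj_on x {..<2}} \<subseteq> {(y, z). y \<in> X \<and> z \<in> X \<and> y \<noteq> z}"
    proof (rule image_subsetI)
      fix x
      assume x: "x \<in> {x \<in> {..<2::nat} \<rightarrow>\<^sub>E X. inj_on x {..<2}}"
      then have "x 0 \<in> X" "x 1 \<in> X"
        using PiE_mem[of x "{..<2}" "\<lambda>_. X"] by simp_all
      moreover have "x 0 \<noteq> x 1"
      proof
        assume "x 0 = x 1"
        then have "0 = (1::nat)"
          using x by (intro inj_onD[of x "{..<2}" 0 1]) simp_all
        then show False
          by simp
      qed
      ultimately show "(x 0, x 1) \<in> {(y, z). y \<in> X \<and> z \<in> X \<and> y \<noteq> z}"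
        by simp
    qed
    show "\<forall>p\<in>{(y, z). y \<in> X \<and> z \<in> X \<and> y \<noteq> z}.
        (\<lambda>x. (x 0, x 1)) (case p of (y, z) \<Rightarrow> \<lambda>i\<in>{..<2::nat}. if i = 0 then y else z) = p"
      by (simp add: split_beta)
    show "(\<lambda>(y, z). \<lambda>i\<in>{..<2}. if i = 0 then y else z) ` {(y, z). y \<in> X \<and> z \<in> X \<and> y \<noteq> z}
        \<subseteq> {x \<in> {..<2::nat} \<rightarrow>\<^sub>E X. inj_on x {..<2}}"
    proof (rule image_subsetI)
      fix p
      assume "p \<in> {(y, z). y \<in> X \<and> z \<in> X \<and> y \<noteq> z}"
      then obtain y z where p: "p = (y, z)" "y \<in> X" "z \<in> X" "y \<noteq> z"
        by blast
      have "inj_on (\<lambda>i\<in>{..<2::nat}. if i = 0 then y else z) {..<2}"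
        by (rule inj_onI) (use p(4) in \<open>simp add: less_2_cases_iff split: if_splits\<close>)
      with p show "(case p of (y, z) \<Rightarrow> \<lambda>i\<in>{..<2}. if i = 0 then y else z)
          \<in> {x \<in> {..<2::nat} \<rightarrow>\<^sub>E X. inj_on x {..<2}}"
        by simp
    qed
  qed
  from nn_integral_bij_count_space[OF this, of "\<lambda>p. F (fst p) (snd p)"]
  show ?thesis by simp
qed

lemma nn_integral_tuple_1:
  assumes "sigma_finite_measure \<mu>" "F \<in> borel_measurable \<mu>"
  shows "(\<integral>\<^sup>+x. F (x 0) \<partial>(\<Pi>\<^sub>M i\<in>{..<1::nat}. \<mu>)) = (\<integral>\<^sup>+z. F z \<partial>\<mu>)"
proof -
  interpret sigma_finite_measure \<mu> by fact
  interpret product_sigma_finite "\<lambda>_::nat. \<mu>" by standard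
  have "{..<1::nat} = {0}" by auto
  then show ?thesis
    using product_nn_integral_singleton[OF assms(2)] by (simp only:)
qed

lemma nn_integral_tuple_2:
  assumes "sigma_finite_measure \<mu>" "(\<lambda>p. F (fst p) (snd p)) \<in> borel_measurable (\<mu> \<Otimes>\<^sub>M \<mu>)"
  shows "(\<integral>\<^sup>+x. F (x 0) (x 1) \<partial>(\<Pi>\<^sub>M i\<in>{..<2::nat}. \<mu>)) = (\<integral>\<^sup>+y. (\<integral>\<^sup>+z. F y z \<partial>\<mu>) \<partial>\<mu>)"
proof -
  interpret sigma_finite_measure \<mu> by fact
  interpret product_sigma_finite "\<lambda>_::nat. \<mu>" by standard
  have [measurable]: "(\<lambda>x. F (f x) (g x)) \<in> borel_measurable N"
    if "f \<in> N \<rightarrow>\<^sub>M \<mu>" "g \<in> N \<rightarrow>\<^sub>M \<mu>" for f g and N :: "'b measure"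
    using measurable_compose[OF measurable_Pair[OF that] assms(2)] by simp
  have [measurable]: "(\<lambda>x::nat \<Rightarrow> 'a. F (x 0) (x 1)) \<in> borel_measurable (\<Pi>\<^sub>M i\<in>insert 0 {1::nat}. \<mu>)"
    using measurable_compose[OF measurable_Pair assms(2), of "\<lambda>x. x 0" "\<Pi>\<^sub>M i\<in>insert 0 {1::nat}. \<mu>" "\<lambda>x. x 1"]
    by simp
  \<comment> \<open>In this form the index set can be peeled: coordinate 0 becomes the outer
    variable and a singleton product remains.\<close>
  have "{..<2::nat} = insert 0 {1}" by auto
  then have "(\<integral>\<^sup>+x. F (x 0) (x 1) \<partial>(\<Pi>\<^sub>M i\<in>{..<2::nat}. \<mu>)) =
      (\<integral>\<^sup>+y. (\<integral>\<^sup>+x. F y (x 1) \<partial>(\<Pi>\<^sub>M i\<in>{1::nat}. \<mu>)) \<partial>\<mu>)"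
    by (simp add: product_nn_integral_insert_rev)
  also have "\<dots> = (\<integral>\<^sup>+y. (\<integral>\<^sup>+z. F y z \<partial>\<mu>) \<partial>\<mu>)"
  proof (intro nn_integral_cong)
    fix y assume "y \<in> space \<mu>"
    then have "F y \<in> borel_measurable \<mu>"
      using measurable_compose[OF measurable_Pair[OF measurable_const measurable_ident] assms(2), of y] by simp
    then show "(\<integral>\<^sup>+x. F y (x 1) \<partial>(\<Pi>\<^sub>M i\<in>{1::nat}. \<mu>)) = (\<integral>\<^sup>+z. F y z \<partial>\<mu>)"
      by (rule product_nn_integral_singleton)
  qed
  finally show ?thesis .
qed

section \<open>Small determinants and the Gaussian background measure\<close>

lemma det_mat_1: "Determinant.det (Matrix.mat 1 1 f) = f (0, 0)"
  by (subst det_single) auto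

lemma det_mat_2:
  "Determinant.det (Matrix.mat 2 2 f) = f (0, 0) * f (1, 1) - f (0, 1) * (f (1, 0) :: 'a :: comm_ring_1)"
proof -
  have "mat_delete (Matrix.mat 2 2 f) 0 j \<in> carrier_mat 1 1" for j
    by (auto simp: mat_delete_def)
  then show ?thesis
    by (subst laplace_expansion_row[of _ 2 0])
       (auto simp: cofactor_def det_single mat_delete_def lessThan_nat_numeral lessThan_Suc numeral_2_eq_2)
qed

lemma k_point_intensityD:
  assumes "k_point_intensity M X \<mu> k \<rho>" "f \<in> borel_measurable (\<Pi>\<^sub>M i\<in>{..<k}. \<mu>)"
  shows "(\<integral>\<^sup>+\<omega>. (\<integral>\<^sup>+x. f x \<partial>count_space {x \<in> {..<k} \<rightarrow>\<^sub>E X \<omega>. inj_on x {..<k}}) \<partial>M) =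
    (\<integral>\<^sup>+x. f x * ennreal (\<rho> x) \<partial>(\<Pi>\<^sub>M i\<in>{..<k}. \<mu>))"
  using assms by (simp add: k_point_intensity_def)

text \<open>The factor \<open>1 / pi\<close> normalises the Gaussian. The result supplies the
  sigma-finiteness required for product integrals.\<close>

lemma prob_space_ginibre_background: "prob_space ginibre_background"
proof
  have "emeasure ginibre_background (space ginibre_background) =
      (\<integral>\<^sup>+z. ennreal (1 / pi) * ennreal (exp (- (1 * (cmod z)\<^sup>2))) \<partial>lborel)"
    by (simp add: ginibre_background_def emeasure_density flip: ennreal_mult')
  also have "\<dots> = 1"
    by (subst nn_integral_cmult) (simp_all only: nn_integral_gaussian_complex, auto simp flip: ennreal_mult')
  finally show "emeasure ginibre_background (space ginibre_background) = 1" .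
qed

lemma sets_ginibre_background [measurable_cong]: "sets ginibre_background = sets borel"
  by (simp add: ginibre_background_def)

lemma nn_integral_ginibre_background:
  assumes [measurable]: "f \<in> borel_measurable borel"
  shows "(\<integral>\<^sup>+z. f z \<partial>ginibre_background) = (\<integral>\<^sup>+z. ennreal (exp (- (cmod z)\<^sup>2) / pi) * f z \<partial>lborel)"
  by (simp add: ginibre_background_def nn_integral_density)

lemma ginibre_kernel_diag: "ginibre_kernel z z = complex_of_real (exp ((cmod z)\<^sup>2))"
  by (simp only: ginibre_kernel_def exp_of_real[symmetric] complex_norm_square)

text \<open>The diagonal value exp(|z|^2) of the kernel cancels the Gaussian factor of the
  background density, so the intensity with respect to Lebesgue measure is the constant
  \<open>1 / pi\<close>.\<close>

lemma ginibre_intensity_1: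
  assumes "infinite_ginibre_ensemble M G" and [measurable]: "f \<in> borel_measurable borel"
  shows "(\<integral>\<^sup>+\<omega>. (\<integral>\<^sup>+x. f x \<partial>count_space (G \<omega>)) \<partial>M) = (\<integral>\<^sup>+z. ennreal (1 / pi) * f z \<partial>lborel)"
proof -
  interpret prob_space ginibre_background
    by (rule prob_space_ginibre_background)
  obtain \<rho> where \<rho>: "k_point_intensity M G ginibre_background 1 \<rho>"
    "\<And>x. complex_of_real (\<rho> x) =
       Determinant.det (Matrix.mat 1 1 (\<lambda>(i, j). ginibre_kernel (x i) (x j)))"
    using assms(1) unfolding infinite_ginibre_ensemble_def determinantal_point_process_def by blast
  have "complex_of_real (\<rho> x) = complex_of_real (exp ((cmod (x 0))\<^sup>2))" for x
    unfolding \<rho>(2) det_mat_1 by (simp only: prod.case ginibre_kernel_diag)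
  then have \<rho>_eq: "\<rho> x = exp ((cmod (x 0))\<^sup>2)" for x
    by (simp only: of_real_eq_iff)
  have meas: "(\<lambda>x. f (x 0)) \<in> borel_measurable (\<Pi>\<^sub>M i\<in>{..<1::nat}. ginibre_background)"
    by measurable
  have "(\<integral>\<^sup>+\<omega>. (\<integral>\<^sup>+x. f x \<partial>count_space (G \<omega>)) \<partial>M) =
      (\<integral>\<^sup>+x. f (x 0) * ennreal (\<rho> x) \<partial>(\<Pi>\<^sub>M i\<in>{..<1::nat}. ginibre_background))"
    using k_point_intensityD[OF \<rho>(1) meas] by (simp only: nn_integral_count_space_tuple_1[where F = f])
  also have "\<dots> = (\<integral>\<^sup>+z. f z * ennreal (exp ((cmod z)\<^sup>2)) \<partial>ginibre_background)"
    unfolding \<rho>_eq by (rule nn_integral_tuple_1[OF sigma_finite_measure_axioms]) measurable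
  also have "\<dots> = (\<integral>\<^sup>+z. ennreal (1 / pi) * f z \<partial>lborel)"
  proof (subst nn_integral_ginibre_background, measurable, intro nn_integral_cong)
    fix z
    have "ennreal (exp (- (cmod z)\<^sup>2) / pi) * (f z * ennreal (exp ((cmod z)\<^sup>2))) =
        ennreal (exp (- (cmod z)\<^sup>2) / pi * exp ((cmod z)\<^sup>2)) * f z"
      by (simp only: ennreal_mult' divide_nonneg_nonneg exp_ge_zero pi_ge_zero) (simp only: mult_ac)
    then show "ennreal (exp (- (cmod z)\<^sup>2) / pi) * (f z * ennreal (exp ((cmod z)\<^sup>2))) = ennreal (1 / pi) * f z"
      by (simp add: exp_minus)
  qed
  finally show ?thesis .
qed

text \<open>The two exponents add up to \<open>z * cnj w + w * cnj z\<close>, the cross term in the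
  expansion of |w - z|^2. The product is |K(z, w)|^2, written so that Gaussian weights reduce it to
  a function of the distance.\<close>

lemma ginibre_kernel_swap:
  "ginibre_kernel z w * ginibre_kernel w z =
     complex_of_real (exp ((cmod z)\<^sup>2 + (cmod w)\<^sup>2 - (cmod (w - z))\<^sup>2))"
proof -
  have "complex_of_real ((cmod z)\<^sup>2 + (cmod w)\<^sup>2 - (cmod (w - z))\<^sup>2) = z * cnj w + w * cnj z"
    by (simp only: of_real_diff of_real_add complex_norm_square) (simp add: algebra_simps)
  then show ?thesis
    by (simp only: ginibre_kernel_def exp_of_real[symmetric] exp_add)
qed

text \<open>The determinant is K(y, y) K(z, z) - |K(y, z)|^2. The background densities cancel its
  growth, leaving a translation-invariant intensity that vanishes at \<open>y = z\<close>: the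
  points repel each other.\<close>

lemma ginibre_intensity_2:
  assumes "infinite_ginibre_ensemble M G"
    and F [measurable]: "(\<lambda>p. F (fst p) (snd p)) \<in> borel_measurable (borel \<Otimes>\<^sub>M borel)"
  shows "(\<integral>\<^sup>+\<omega>. (\<integral>\<^sup>+p. F (fst p) (snd p) \<partial>count_space {(y, z). y \<in> G \<omega> \<and> z \<in> G \<omega> \<and> y \<noteq> z}) \<partial>M) =
    (\<integral>\<^sup>+y. (\<integral>\<^sup>+z. ennreal ((1 - exp (- (cmod (z - y))\<^sup>2)) / pi\<^sup>2) * F y z \<partial>lborel) \<partial>lborel)"
proof -
  interpret prob_space ginibre_background
    by (rule prob_space_ginibre_background)
  \<comment> \<open>The 2 by 2 kernel determinant with the factor K(y, y) K(z, z) pulled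
    out.\<close>
  define h where "h y z = exp ((cmod y)\<^sup>2 + (cmod z)\<^sup>2) * (1 - exp (- (cmod (z - y))\<^sup>2))" for y z
  obtain \<rho> where \<rho>: "k_point_intensity M G ginibre_background 2 \<rho>"
    "\<And>x. complex_of_real (\<rho> x) =
       Determinant.det (Matrix.mat 2 2 (\<lambda>(i, j). ginibre_kernel (x i) (x j)))"
    using assms(1) unfolding infinite_ginibre_ensemble_def determinantal_point_process_def
    by (metis one_le_numeral)
  have "complex_of_real (\<rho> x) = complex_of_real (h (x 0) (x 1))" for x
  proof -
    have "complex_of_real (\<rho> x) = complex_of_real (exp ((cmod (x 0))\<^sup>2) * exp ((cmod (x 1))\<^sup>2) -
        exp ((cmod (x 0))\<^sup>2 + (cmod (x 1))\<^sup>2 - (cmod (x 1 - x 0))\<^sup>2))"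
      unfolding \<rho>(2) det_mat_2 by (simp only: prod.case ginibre_kernel_swap ginibre_kernel_diag of_real_diff of_real_mult)
    also have "exp ((cmod (x 0))\<^sup>2) * exp ((cmod (x 1))\<^sup>2) -
        exp ((cmod (x 0))\<^sup>2 + (cmod (x 1))\<^sup>2 - (cmod (x 1 - x 0))\<^sup>2) = h (x 0) (x 1)"
      unfolding h_def by (simp add: right_diff_distrib flip: exp_add)
    finally show ?thesis .
  qed
  then have \<rho>_eq: "\<rho> x = h (x 0) (x 1)" for x
    by (simp only: of_real_eq_iff)
  have h_meas [measurable]: "(\<lambda>p. h (fst p) (snd p)) \<in> borel_measurable (borel \<Otimes>\<^sub>M borel)"
    unfolding h_def by measurable
  have meas: "(\<lambda>x. F (x 0) (x 1)) \<in> borel_measurable (\<Pi>\<^sub>M i\<in>{..<2::nat}. ginibre_background)"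
    using measurable_compose[OF measurable_Pair F, of "\<lambda>x. x 0" "\<Pi>\<^sub>M i\<in>{..<2::nat}. ginibre_background" "\<lambda>x. x 1"]
    by (simp add: measurable_cong_sets[OF refl sets_ginibre_background[symmetric]])
  have Fh: "(\<lambda>p. F (fst p) (snd p) * ennreal (h (fst p) (snd p)))
      \<in> borel_measurable (ginibre_background \<Otimes>\<^sub>M ginibre_background)"
    by measurable
  have F1 [measurable]: "F y \<in> borel_measurable borel" for y
    using measurable_compose[OF measurable_Pair[OF measurable_const measurable_ident] F, of y] by simp
  have h1 [measurable]: "h y \<in> borel_measurable borel" for y
    unfolding h_def by measurable
  have "(\<integral>\<^sup>+\<omega>. (\<integral>\<^sup>+p. F (fst p) (snd p) \<partial>count_space {(y, z). y \<in> G \<omega> \<and> z \<in> G \<omega> \<and> y \<noteq> z}) \<partial>M) =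
      (\<integral>\<^sup>+x. F (x 0) (x 1) * ennreal (\<rho> x) \<partial>(\<Pi>\<^sub>M i\<in>{..<2::nat}. ginibre_background))"
    using k_point_intensityD[OF \<rho>(1) meas] by (simp only: nn_integral_count_space_tuple_2[where F = F])
  also have "\<dots> = (\<integral>\<^sup>+y. (\<integral>\<^sup>+z. F y z * ennreal (h y z) \<partial>ginibre_background) \<partial>ginibre_background)"
    unfolding \<rho>_eq by (rule nn_integral_tuple_2[OF sigma_finite_measure_axioms Fh])
  also have "\<dots> = (\<integral>\<^sup>+y. ennreal (exp (- (cmod y)\<^sup>2) / pi) *
      (\<integral>\<^sup>+z. F y z * ennreal (h y z) \<partial>ginibre_background) \<partial>lborel)"
  proof (rule nn_integral_ginibre_background)
    have "(\<lambda>y. \<integral>\<^sup>+z. (\<lambda>(y, z). F y z * ennreal (h y z)) (y, z) \<partial>ginibre_background) \<in> borel_measurable ginibre_background"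
      by (rule borel_measurable_nn_integral_fst) (use Fh in \<open>simp add: case_prod_unfold\<close>)
    then show "(\<lambda>y. \<integral>\<^sup>+z. F y z * ennreal (h y z) \<partial>ginibre_background) \<in> borel_measurable borel"
      by simp
  qed
  also have "\<dots> = (\<integral>\<^sup>+y. (\<integral>\<^sup>+z. ennreal (exp (- (cmod y)\<^sup>2) / pi) * (ennreal (exp (- (cmod z)\<^sup>2) / pi) *
      (F y z * ennreal (h y z))) \<partial>lborel) \<partial>lborel)"
    by (subst nn_integral_ginibre_background) (auto simp: nn_integral_cmult)
  also have "\<dots> = (\<integral>\<^sup>+y. (\<integral>\<^sup>+z. ennreal ((1 - exp (- (cmod (z - y))\<^sup>2)) / pi\<^sup>2) * F y z \<partial>lborel) \<partial>lborel)"
  proof (intro nn_integral_cong)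
    fix y z :: complex
    have e: "exp (- (cmod y)\<^sup>2) * exp (- (cmod z)\<^sup>2) * exp ((cmod y)\<^sup>2 + (cmod z)\<^sup>2) = 1"
      by (simp flip: exp_add)
    have "ennreal (exp (- (cmod y)\<^sup>2) / pi) * (ennreal (exp (- (cmod z)\<^sup>2) / pi) * (F y z * ennreal (h y z))) =
        ennreal (exp (- (cmod y)\<^sup>2) / pi * (exp (- (cmod z)\<^sup>2) / pi * h y z)) * F y z"
      by (simp only: ennreal_mult' divide_nonneg_nonneg exp_ge_zero pi_ge_zero) (simp only: mult_ac)
    also have "exp (- (cmod y)\<^sup>2) / pi * (exp (- (cmod z)\<^sup>2) / pi * h y z) =
        exp (- (cmod y)\<^sup>2) * exp (- (cmod z)\<^sup>2) * exp ((cmod y)\<^sup>2 + (cmod z)\<^sup>2) *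
        (1 - exp (- (cmod (z - y))\<^sup>2)) / pi\<^sup>2"
      unfolding h_def by (simp add: power2_eq_square mult.assoc)
    also have "\<dots> = (1 - exp (- (cmod (z - y))\<^sup>2)) / pi\<^sup>2"
      by (simp only: e mult_1)
    finally show "ennreal (exp (- (cmod y)\<^sup>2) / pi) * (ennreal (exp (- (cmod z)\<^sup>2) / pi) * (F y z * ennreal (h y z))) =
        ennreal ((1 - exp (- (cmod (z - y))\<^sup>2)) / pi\<^sup>2) * F y z" .
  qed
  finally show ?thesis .
qed

section \<open>The variance of a linear statistic\<close>

lemma infinite_ginibre_ensembleD:
  assumes "infinite_ginibre_ensemble M G"
  shows "prob_space M" "G \<in> M \<rightarrow>\<^sub>M configuration_space UNIV"
    and "\<omega> \<in> space M \<Longrightarrow> compact C \<Longrightarrow> finite (G \<omega> \<inter> C)"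
proof -
  show "prob_space M" and G: "G \<in> M \<rightarrow>\<^sub>M configuration_space UNIV"
    using assms by (simp_all add: infinite_ginibre_ensemble_def determinantal_point_process_def point_process_def)
  show "\<omega> \<in> space M \<Longrightarrow> compact C \<Longrightarrow> finite (G \<omega> \<inter> C)"
    using measurable_space[OF G, of \<omega>] by (simp add: configurations_def)
qed

text \<open>The constant is the mean, so the left side is twice the variance. All moments are
  extended nonnegative reals, so each identity is arranged as an equality of sums, and a finite
  common summand is cancelled at the end.\<close>

lemma variance_linear_statistic:
  assumes ginibre: "infinite_ginibre_ensemble M G"
    and cont: "continuous_on UNIV \<phi>"
    and bound: "\<And>z. 0 \<le> \<phi> z" "\<And>z. \<phi> z \<le> 1"
    and supp: "\<And>z. z \<notin> cball 0 R \<Longrightarrow> \<phi> z = 0"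
  shows "\<exists>c. 2 * (\<integral>\<^sup>+\<omega>. ennreal (((\<integral>x. \<phi> x \<partial>count_space (G \<omega>)) - c)\<^sup>2) \<partial>M) =
    (\<integral>\<^sup>+y. (\<integral>\<^sup>+z. ennreal ((\<phi> y - \<phi> z)\<^sup>2 * exp (- (cmod (z - y))\<^sup>2) / pi\<^sup>2) \<partial>lborel) \<partial>lborel)"
proof -
  interpret prob_space M
    using ginibre by (rule infinite_ginibre_ensembleD)
  note G = infinite_ginibre_ensembleD(2)[OF ginibre]
  note fin = infinite_ginibre_ensembleD(3)[OF ginibre _ compact_cball[of 0 R]]
  have \<phi>_meas [measurable]: "\<phi> \<in> borel_measurable borel"
    using cont by (rule borel_measurable_continuous_onI)
  have sq: "continuous_on UNIV (\<lambda>z. (\<phi> z)\<^sup>2)" "\<And>z. z \<notin> cball 0 R \<Longrightarrow> (\<phi> z)\<^sup>2 = 0"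
    by (intro continuous_on_power cont) (simp_all add: supp)
  have tf: "\<phi> \<in> test_functions UNIV" "(\<lambda>z. (\<phi> z)\<^sup>2) \<in> test_functions UNIV"
    by (rule test_functions_UNIV[where R = R], fact cont, fact supp,
        rule test_functions_UNIV[where R = R], fact sq(1), fact sq(2))
  define S where "S \<omega> = (\<integral>x. \<phi> x \<partial>count_space (G \<omega>))" for \<omega>
  define T where "T \<omega> = (\<integral>x. (\<phi> x)\<^sup>2 \<partial>count_space (G \<omega>))" for \<omega>
  define P where "P \<omega> = (\<integral>\<^sup>+p. ennreal (\<phi> (fst p) * \<phi> (snd p))
      \<partial>count_space {(y, z). y \<in> G \<omega> \<and> z \<in> G \<omega> \<and> y \<noteq> z})" for \<omega>
  have [measurable]: "S \<in> borel_measurable M" "T \<in> borel_measurable M"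
    unfolding S_def T_def
    by (rule measurable_compose[OF G borel_measurable_linear_statistic[OF tf(1)]],
        rule measurable_compose[OF G borel_measurable_linear_statistic[OF tf(2)]])
  have S_nonneg: "S \<omega> \<ge> 0" for \<omega>
    unfolding S_def by (rule integral_nonneg_AE) (simp add: bound)
  \<comment> \<open>The means of \<open>S\<close>, \<open>T\<close> and \<open>P\<close> will be
    \<open>m\<close>, \<open>B\<close> and \<open>A'\<close>. \<open>A\<close> integrates
    \<open>\<phi> y * \<phi> z\<close> against |K(y, z)|^2 with both background densities, and
    \<open>V\<close> is the claimed right-hand side.\<close>
  define m where "m = (\<integral>\<^sup>+z. ennreal (\<phi> z / pi) \<partial>lborel)"
  define B where "B = (\<integral>\<^sup>+z. ennreal ((\<phi> z)\<^sup>2 / pi) \<partial>lborel)"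
  define A where "A = (\<integral>\<^sup>+y. (\<integral>\<^sup>+z. ennreal (\<phi> y * \<phi> z * exp (- (cmod (z - y))\<^sup>2) / pi\<^sup>2) \<partial>lborel) \<partial>lborel)"
  define A' where "A' = (\<integral>\<^sup>+y. (\<integral>\<^sup>+z. ennreal (\<phi> y * \<phi> z * (1 - exp (- (cmod (z - y))\<^sup>2)) / pi\<^sup>2) \<partial>lborel) \<partial>lborel)"
  define V where "V = (\<integral>\<^sup>+y. (\<integral>\<^sup>+z. ennreal ((\<phi> y - \<phi> z)\<^sup>2 * exp (- (cmod (z - y))\<^sup>2) / pi\<^sup>2) \<partial>lborel) \<partial>lborel)"

  \<comment> \<open>First and second moments of the linear statistic\<close>
  have ES: "(\<integral>\<^sup>+\<omega>. ennreal (S \<omega>) \<partial>M) = m"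
  proof -
    have "(\<integral>\<^sup>+\<omega>. ennreal (S \<omega>) \<partial>M) = (\<integral>\<^sup>+\<omega>. (\<integral>\<^sup>+x. ennreal (\<phi> x) \<partial>count_space (G \<omega>)) \<partial>M)"
      unfolding S_def by (intro nn_integral_cong nn_integral_count_space_compact_support[symmetric, OF fin supp bound(1)])
    also have "\<dots> = (\<integral>\<^sup>+z. ennreal (1 / pi) * ennreal (\<phi> z) \<partial>lborel)"
      by (rule ginibre_intensity_1[OF ginibre]) measurable
    also have "\<dots> = m"
      unfolding m_def by (simp add: bound flip: ennreal_mult')
    finally show ?thesis .
  qed
  have ET: "(\<integral>\<^sup>+\<omega>. ennreal (T \<omega>) \<partial>M) = B"
  proof -
    have "(\<integral>\<^sup>+\<omega>. ennreal (T \<omega>) \<partial>M) = (\<integral>\<^sup>+\<omega>. (\<integral>\<^sup>+x. ennreal ((\<phi> x)\<^sup>2) \<partial>count_space (G \<omega>)) \<partial>M)"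
      unfolding T_def by (intro nn_integral_cong nn_integral_count_space_compact_support[symmetric, OF fin sq(2) zero_le_power2])
    also have "\<dots> = (\<integral>\<^sup>+z. ennreal (1 / pi) * ennreal ((\<phi> z)\<^sup>2) \<partial>lborel)"
      by (rule ginibre_intensity_1[OF ginibre]) measurable
    also have "\<dots> = B"
      unfolding B_def by (simp flip: ennreal_mult')
    finally show ?thesis .
  qed
  have EP: "(\<integral>\<^sup>+\<omega>. P \<omega> \<partial>M) = A'"
  proof -
    have "(\<integral>\<^sup>+\<omega>. P \<omega> \<partial>M) =
        (\<integral>\<^sup>+y. (\<integral>\<^sup>+z. ennreal ((1 - exp (- (cmod (z - y))\<^sup>2)) / pi\<^sup>2) * ennreal (\<phi> y * \<phi> z) \<partial>lborel) \<partial>lborel)"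
      unfolding P_def by (rule ginibre_intensity_2[OF ginibre, where F = "\<lambda>y z. ennreal (\<phi> y * \<phi> z)"]) measurable
    also have "\<dots> = A'"
      unfolding A'_def by (simp add: bound mult_ac flip: ennreal_mult')
    finally show ?thesis .
  qed
  have S2: "ennreal ((S \<omega>)\<^sup>2) = ennreal (T \<omega>) + P \<omega>" if "\<omega> \<in> space M" for \<omega>
  proof -
    have "ennreal ((S \<omega>)\<^sup>2) = (\<integral>\<^sup>+x. ennreal ((\<phi> x)\<^sup>2) \<partial>count_space (G \<omega>)) + P \<omega>"
      unfolding S_def P_def by (rule square_linear_statistic[OF fin[OF that]], fact supp, fact bound(1))
    also have "(\<integral>\<^sup>+x. ennreal ((\<phi> x)\<^sup>2) \<partial>count_space (G \<omega>)) = ennreal (T \<omega>)"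
      unfolding T_def
      by (rule nn_integral_count_space_compact_support[OF fin[OF that]], fact sq(2), rule zero_le_power2)
    finally show ?thesis .
  qed
  \<comment> \<open>An integral over the pairs of a random set is not visibly measurable, so
    \<open>P\<close> is recovered as the square of \<open>S\<close> minus \<open>T\<close>, where
    \<open>T\<close> is real and hence finite.\<close>
  have P_meas: "P \<in> borel_measurable M"
  proof -
    have "(\<lambda>\<omega>. ennreal ((S \<omega>)\<^sup>2) - ennreal (T \<omega>)) \<in> borel_measurable M"
      by measurable
    moreover have "ennreal ((S \<omega>)\<^sup>2) - ennreal (T \<omega>) = P \<omega>" if "\<omega> \<in> space M" for \<omega>
      unfolding S2[OF that] by simp
    ultimately show ?thesis
      by (simp cong: measurable_cong)
  qed
  have ES2: "(\<integral>\<^sup>+\<omega>. ennreal ((S \<omega>)\<^sup>2) \<partial>M) = B + A'"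
  proof -
    have "(\<integral>\<^sup>+\<omega>. ennreal ((S \<omega>)\<^sup>2) \<partial>M) = (\<integral>\<^sup>+\<omega>. ennreal (T \<omega>) + P \<omega> \<partial>M)"
      by (intro nn_integral_cong S2)
    also have "\<dots> = B + A'"
      using P_meas by (simp add: nn_integral_add ET EP)
    finally show ?thesis .
  qed

  \<comment> \<open>Compact support and the bound by 1 put the integrand below the indicator of a
    ball. Finiteness of \<open>m\<close> makes it a real centring constant and permits the final
    cancellation.\<close>
  have m_fin: "m < \<infinity>"
  proof -
    have "m \<le> (\<integral>\<^sup>+z. indicator (cball (0::complex) R) z \<partial>lborel)"
      unfolding m_def
    proof (intro nn_integral_mono)
      fix z
      have "\<phi> z / pi \<le> 1"
        using bound(2)[of z] pi_ge_two by (simp add: field_simps)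
      then show "ennreal (\<phi> z / pi) \<le> indicator (cball 0 R) z"
        using supp[of z] by (cases "z \<in> cball 0 R") (simp_all add: ennreal_leI)
    qed
    also have "\<dots> < \<infinity>"
      using emeasure_lborel_cball_finite[of "0::complex" R] by simp
    finally show ?thesis .
  qed
  \<comment> \<open>The weights \<open>exp (- t)\<close> and \<open>1 - exp (- t)\<close> add up to
    1, so the double integral factors.\<close>
  have AA': "A + A' = m * m"
  proof -
    have "A + A' = (\<integral>\<^sup>+y. (\<integral>\<^sup>+z. ennreal (\<phi> y * \<phi> z * exp (- (cmod (z - y))\<^sup>2) / pi\<^sup>2) +
         ennreal (\<phi> y * \<phi> z * (1 - exp (- (cmod (z - y))\<^sup>2)) / pi\<^sup>2) \<partial>lborel) \<partial>lborel)"
      unfolding A_def A'_def by (simp add: nn_integral_add)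
    also have "\<dots> = (\<integral>\<^sup>+y. (\<integral>\<^sup>+z. ennreal (\<phi> y / pi) * ennreal (\<phi> z / pi) \<partial>lborel) \<partial>lborel)"
    proof (intro nn_integral_cong)
      fix y z
      have "ennreal (\<phi> y * \<phi> z * exp (- (cmod (z - y))\<^sup>2) / pi\<^sup>2) +
         ennreal (\<phi> y * \<phi> z * (1 - exp (- (cmod (z - y))\<^sup>2)) / pi\<^sup>2) =
         ennreal (\<phi> y * \<phi> z * exp (- (cmod (z - y))\<^sup>2) / pi\<^sup>2 + \<phi> y * \<phi> z * (1 - exp (- (cmod (z - y))\<^sup>2)) / pi\<^sup>2)"
        by (rule ennreal_plus[symmetric]) (simp_all add: bound)
      also have "\<phi> y * \<phi> z * exp (- (cmod (z - y))\<^sup>2) / pi\<^sup>2 + \<phi> y * \<phi> z * (1 - exp (- (cmod (z - y))\<^sup>2)) / pi\<^sup>2 =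
         \<phi> y / pi * (\<phi> z / pi)"
        by (simp add: right_diff_distrib power2_eq_square flip: add_divide_distrib)
      also have "ennreal \<dots> = ennreal (\<phi> y / pi) * ennreal (\<phi> z / pi)"
        by (rule ennreal_mult) (simp_all add: bound)
      finally show "ennreal (\<phi> y * \<phi> z * exp (- (cmod (z - y))\<^sup>2) / pi\<^sup>2) +
         ennreal (\<phi> y * \<phi> z * (1 - exp (- (cmod (z - y))\<^sup>2)) / pi\<^sup>2) =
         ennreal (\<phi> y / pi) * ennreal (\<phi> z / pi)" .
    qed
    also have "\<dots> = m * m"
      unfolding m_def by (simp add: nn_integral_cmult nn_integral_multc)
    finally show ?thesis .
  qed
  \<comment> \<open>reproducing property of the kernel: integrating out one variable of \<open>|K(y, z)|\<^sup>2\<close> gives \<open>K(y, y)\<close>\<close>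
  have B_left: "(\<integral>\<^sup>+y. (\<integral>\<^sup>+z. ennreal ((\<phi> y)\<^sup>2 * exp (- (cmod (z - y))\<^sup>2) / pi\<^sup>2) \<partial>lborel) \<partial>lborel) = B"
    unfolding B_def
  proof (intro nn_integral_cong)
    fix y
    have "(\<integral>\<^sup>+z. ennreal ((\<phi> y)\<^sup>2 * exp (- (cmod (z - y))\<^sup>2) / pi\<^sup>2) \<partial>lborel) =
        (\<integral>\<^sup>+z. ennreal ((\<phi> y)\<^sup>2 / pi\<^sup>2) * ennreal (exp (- (cmod (z - y))\<^sup>2)) \<partial>lborel)"
      by (simp flip: ennreal_mult')
    also have "\<dots> = ennreal ((\<phi> y)\<^sup>2 / pi\<^sup>2) * ennreal pi"
      by (simp add: nn_integral_cmult nn_integral_exp_translate)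
    also have "\<dots> = ennreal ((\<phi> y)\<^sup>2 / pi)"
      by (simp add: power2_eq_square flip: ennreal_mult')
    finally show "(\<integral>\<^sup>+z. ennreal ((\<phi> y)\<^sup>2 * exp (- (cmod (z - y))\<^sup>2) / pi\<^sup>2) \<partial>lborel) = ennreal ((\<phi> y)\<^sup>2 / pi)" .
  qed
  \<comment> \<open>Tonelli exchanges the variables, and symmetry of the Gaussian in
    \<open>y\<close> and \<open>z\<close> reduces this to the previous identity.\<close>
  have B_right: "(\<integral>\<^sup>+y. (\<integral>\<^sup>+z. ennreal ((\<phi> z)\<^sup>2 * exp (- (cmod (z - y))\<^sup>2) / pi\<^sup>2) \<partial>lborel) \<partial>lborel) = B"
  proof -
    have "(\<integral>\<^sup>+y. (\<integral>\<^sup>+z. ennreal ((\<phi> z)\<^sup>2 * exp (- (cmod (z - y))\<^sup>2) / pi\<^sup>2) \<partial>lborel) \<partial>lborel) =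
        (\<integral>\<^sup>+z. (\<integral>\<^sup>+y. ennreal ((\<phi> z)\<^sup>2 * exp (- (cmod (z - y))\<^sup>2) / pi\<^sup>2) \<partial>lborel) \<partial>lborel)"
      by (rule lborel_pair.Fubini') measurable
    also have "\<dots> = B"
      using B_left by (simp add: norm_minus_commute)
    finally show ?thesis .
  qed
  \<comment> \<open>Pointwise, the squared difference plus twice the product is the sum of the two
    squares; each square integrates to \<open>B\<close>.\<close>
  have VA: "V + 2 * A = 2 * B"
  proof -
    have "V + 2 * A = V + A + A"
      by (simp only: mult_2 add.assoc)
    also have "\<dots> = (\<integral>\<^sup>+y. (\<integral>\<^sup>+z. ennreal ((\<phi> y - \<phi> z)\<^sup>2 * exp (- (cmod (z - y))\<^sup>2) / pi\<^sup>2) +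
        ennreal (\<phi> y * \<phi> z * exp (- (cmod (z - y))\<^sup>2) / pi\<^sup>2) +
        ennreal (\<phi> y * \<phi> z * exp (- (cmod (z - y))\<^sup>2) / pi\<^sup>2) \<partial>lborel) \<partial>lborel)"
      unfolding V_def A_def by (simp add: nn_integral_add)
    also have "\<dots> = (\<integral>\<^sup>+y. (\<integral>\<^sup>+z. ennreal ((\<phi> y)\<^sup>2 * exp (- (cmod (z - y))\<^sup>2) / pi\<^sup>2) +
        ennreal ((\<phi> z)\<^sup>2 * exp (- (cmod (z - y))\<^sup>2) / pi\<^sup>2) \<partial>lborel) \<partial>lborel)"
    proof (intro nn_integral_cong)
      fix y z
      define e where "e = exp (- (cmod (z - y))\<^sup>2) / pi\<^sup>2"
      have "e \<ge> 0"
        by (simp add: e_def)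
      then have "ennreal ((\<phi> y - \<phi> z)\<^sup>2 * e) + ennreal (\<phi> y * \<phi> z * e) + ennreal (\<phi> y * \<phi> z * e) =
          ennreal ((\<phi> y - \<phi> z)\<^sup>2 * e + \<phi> y * \<phi> z * e + \<phi> y * \<phi> z * e)"
        by (simp only: ennreal_plus mult_nonneg_nonneg add_nonneg_nonneg zero_le_power2 bound(1))
      also have "(\<phi> y - \<phi> z)\<^sup>2 * e + \<phi> y * \<phi> z * e + \<phi> y * \<phi> z * e = (\<phi> y)\<^sup>2 * e + (\<phi> z)\<^sup>2 * e"
        by (simp add: power2_eq_square algebra_simps)
      also have "ennreal \<dots> = ennreal ((\<phi> y)\<^sup>2 * e) + ennreal ((\<phi> z)\<^sup>2 * e)"
        using \<open>e \<ge> 0\<close> by simp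
      finally show "ennreal ((\<phi> y - \<phi> z)\<^sup>2 * exp (- (cmod (z - y))\<^sup>2) / pi\<^sup>2) +
          ennreal (\<phi> y * \<phi> z * exp (- (cmod (z - y))\<^sup>2) / pi\<^sup>2) +
          ennreal (\<phi> y * \<phi> z * exp (- (cmod (z - y))\<^sup>2) / pi\<^sup>2) =
          ennreal ((\<phi> y)\<^sup>2 * exp (- (cmod (z - y))\<^sup>2) / pi\<^sup>2) +
          ennreal ((\<phi> z)\<^sup>2 * exp (- (cmod (z - y))\<^sup>2) / pi\<^sup>2)"
        by (simp add: e_def)
    qed
    also have "\<dots> = (\<integral>\<^sup>+y. (\<integral>\<^sup>+z. ennreal ((\<phi> y)\<^sup>2 * exp (- (cmod (z - y))\<^sup>2) / pi\<^sup>2) \<partial>lborel) \<partial>lborel) +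
        (\<integral>\<^sup>+y. (\<integral>\<^sup>+z. ennreal ((\<phi> z)\<^sup>2 * exp (- (cmod (z - y))\<^sup>2) / pi\<^sup>2) \<partial>lborel) \<partial>lborel)"
      by (simp add: nn_integral_add)
    also have "\<dots> = B + B"
      by (simp only: B_left B_right)
    finally show ?thesis
      by (simp only: mult_2)
  qed

  \<comment> \<open>Centring at the mean and cancellation\<close>
  define c where "c = enn2real m"
  have c: "ennreal c = m" "c \<ge> 0"
    using m_fin by (simp_all add: c_def)
  define W where "W = (\<integral>\<^sup>+\<omega>. ennreal ((S \<omega> - c)\<^sup>2) \<partial>M)"
  \<comment> \<open>Integrates (S - c)^2 + 2 c S = S^2 + c^2, the subtraction-free form of the
    variance formula; the middle term has mean \<open>2 * (m * m)\<close>.\<close>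
  have W: "W + 2 * (m * m) = B + A' + m * m"
  proof -
    have "W + 2 * (m * m) = W + (\<integral>\<^sup>+\<omega>. ennreal (2 * c) * ennreal (S \<omega>) \<partial>M)"
      using c by (simp add: nn_integral_cmult ES ennreal_mult' mult.assoc)
    also have "\<dots> = (\<integral>\<^sup>+\<omega>. ennreal ((S \<omega> - c)\<^sup>2) + ennreal (2 * c) * ennreal (S \<omega>) \<partial>M)"
      unfolding W_def by (rule nn_integral_add[symmetric]) measurable
    also have "\<dots> = (\<integral>\<^sup>+\<omega>. ennreal ((S \<omega>)\<^sup>2) + ennreal (c\<^sup>2) \<partial>M)"
    proof (intro nn_integral_cong)
      fix \<omega>
      have "ennreal ((S \<omega> - c)\<^sup>2) + ennreal (2 * c) * ennreal (S \<omega>) = ennreal ((S \<omega> - c)\<^sup>2 + 2 * c * S \<omega>)"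
        using c(2) S_nonneg[of \<omega>] by (simp flip: ennreal_mult')
      also have "(S \<omega> - c)\<^sup>2 + 2 * c * S \<omega> = (S \<omega>)\<^sup>2 + c\<^sup>2"
        by (simp add: power2_eq_square algebra_simps)
      finally show "ennreal ((S \<omega> - c)\<^sup>2) + ennreal (2 * c) * ennreal (S \<omega>) = ennreal ((S \<omega>)\<^sup>2) + ennreal (c\<^sup>2)"
        by simp
    qed
    also have "\<dots> = B + A' + ennreal (c\<^sup>2)"
      by (simp add: nn_integral_add ES2 emeasure_space_1)
    also have "ennreal (c\<^sup>2) = m * m"
      using c by (simp add: power2_eq_square ennreal_mult')
    finally show ?thesis .
  qed
  \<comment> \<open>Both sides carry the same summand, which is finite because
    \<open>A \<le> m * m\<close>. It is chosen so that the identities for \<open>A + A'\<close>,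
    \<open>V + 2 * A\<close> and \<open>W\<close> combine without subtraction.\<close>
  have "2 * W + (2 * (m * m) + 2 * (m * m) + 2 * A) = V + (2 * (m * m) + 2 * (m * m) + 2 * A)"
  proof -
    have "2 * W + (2 * (m * m) + 2 * (m * m) + 2 * A) = 2 * (W + 2 * (m * m)) + 2 * A"
      by (simp only: mult_2 add_ac)
    also have "\<dots> = 2 * B + 2 * (A + A') + 2 * (m * m)"
      unfolding W by (simp only: mult_2 add_ac)
    also have "\<dots> = V + (2 * (m * m) + 2 * (m * m) + 2 * A)"
      unfolding AA' VA[symmetric] by (simp only: mult_2 add_ac)
    finally show ?thesis .
  qed
  moreover have "2 * (m * m) + 2 * (m * m) + 2 * A \<noteq> \<infinity>"
  proof -
    have "m * m < \<infinity>"
      using m_fin by (simp add: ennreal_mult_less_top)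
    moreover have "A \<le> m * m"
      unfolding AA'[symmetric] by simp
    ultimately show ?thesis
      by (auto simp: ennreal_mult_eq_top_iff top_unique)
  qed
  ultimately have "2 * W = V"
    by (metis ennreal_add_left_cancel add.commute)
  then show ?thesis
    unfolding W_def V_def S_def by blast
qed

section \<open>Logarithmic cutoffs\<close>

text \<open>Equal to 1 on the disc of radius \<open>r\<close> and to 0 beyond radius
  \<open>r * 2 ^ n\<close>; in the annulus between, it is the harmonic function with these boundary
  values, which minimises the Dirichlet energy. Powers of 2 suit the dyadic estimate below.\<close>

definition log_cutoff :: "real \<Rightarrow> nat \<Rightarrow> complex \<Rightarrow> real" where
  "log_cutoff r n z = max 0 (1 - ln (max r (cmod z) / r) / (real n * ln 2))"

text \<open>
  Divided by \<open>(n ln 2)\<^sup>2\<close> this dominates the squared gradient of the logarithmic cutoff.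
\<close>

definition cutoff_weight :: "real \<Rightarrow> nat \<Rightarrow> complex \<Rightarrow> real" where
  "cutoff_weight r n z = indicator (cball 0 (r * 2 ^ n)) z / (max r (cmod z))\<^sup>2"

context
  fixes r :: real and n :: nat
  assumes r: "r > 0" and n: "n > 0"
begin

section \<open>Pointwise properties of the cutoff\<close>

lemma continuous_on_log_cutoff: "continuous_on UNIV (log_cutoff r n)"
proof -
  have "max r (cmod z) / r \<noteq> 0" for z
    using r by simp
  then show ?thesis
    unfolding log_cutoff_def using r n by (intro continuous_intros) auto
qed

lemma log_cutoff_bounds: "0 \<le> log_cutoff r n z" "log_cutoff r n z \<le> 1"
  using r by (simp_all add: log_cutoff_def)

lemma log_cutoff_inside: "cmod z \<le> r \<Longrightarrow> log_cutoff r n z = 1"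
  using r by (simp add: log_cutoff_def)

lemma log_cutoff_outside:
  assumes "z \<notin> cball 0 (r * 2 ^ n)"
  shows "log_cutoff r n z = 0"
proof -
  have "2 ^ n \<le> max r (cmod z) / r"
    using assms r by (simp add: field_simps)
  then have "ln (2 ^ n) \<le> ln (max r (cmod z) / r)"
    using r by (intro ln_mono) auto
  then have "real n * ln 2 \<le> ln (max r (cmod z) / r)"
    by (simp add: ln_realpow)
  then show ?thesis
    using n by (simp add: log_cutoff_def field_simps)
qed

lemma cutoff_weight_nonneg: "cutoff_weight r n z \<ge> 0"
  by (simp add: cutoff_weight_def)

text \<open>The logarithm is steepest at the smaller modulus, so the weight at \<open>y\<close>
  controls the whole increment. If \<open>y\<close> lies outside the large disc, so does
  \<open>z\<close>, and both values vanish.\<close>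

lemma log_cutoff_diff_le:
  assumes "cmod y \<le> cmod z"
  shows "(log_cutoff r n y - log_cutoff r n z)\<^sup>2 \<le> (cmod (z - y))\<^sup>2 * cutoff_weight r n y / (real n * ln 2)\<^sup>2"
proof (cases "y \<in> cball 0 (r * 2 ^ n)")
  case False
  then have "z \<notin> cball 0 (r * 2 ^ n)"
    using assms by simp
  with False show ?thesis
    by (simp add: log_cutoff_outside cutoff_weight_def)
next
  case True
  define a b where "a = max r (cmod y)" and "b = max r (cmod z)"
  have ab: "0 < a" "0 < b" "a \<le> b"
    using r assms by (auto simp: a_def b_def)
  \<comment> \<open>Truncation by \<open>max 0\<close> is 1-Lipschitz, so it can be removed.\<close>
  have "\<bar>log_cutoff r n y - log_cutoff r n z\<bar> \<le> \<bar>ln (b / r) / (real n * ln 2) - ln (a / r) / (real n * ln 2)\<bar>"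
    unfolding log_cutoff_def a_def b_def by linarith
  also have "\<dots> = (ln b - ln a) / (real n * ln 2)"
    using ab r n by (simp add: ln_div ln_mono flip: diff_divide_distrib)
  also have "\<dots> \<le> (b - a) / a / (real n * ln 2)"
    using ab n by (intro divide_right_mono ln_diff_le) auto
  also have "\<dots> \<le> cmod (z - y) / a / (real n * ln 2)"
  proof -
    have "b - a \<le> cmod (z - y)"
      using assms norm_triangle_ineq2[of z y] unfolding a_def b_def by auto
    then show ?thesis
      using ab n by (intro divide_right_mono) auto
  qed
  finally have "\<bar>log_cutoff r n y - log_cutoff r n z\<bar>\<^sup>2 \<le> (cmod (z - y) / a / (real n * ln 2))\<^sup>2"
    by (intro power_mono) auto
  then show ?thesis
    using True by (simp add: cutoff_weight_def a_def power_divide power_mult_distrib)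
qed

text \<open>Adding both weights covers either order of the moduli and gives a bound that can be
  integrated over all pairs.\<close>

lemma log_cutoff_diff_le_symmetric:
  "(log_cutoff r n y - log_cutoff r n z)\<^sup>2 \<le>
     (cmod (z - y))\<^sup>2 * (cutoff_weight r n y + cutoff_weight r n z) / (real n * ln 2)\<^sup>2"
proof (cases "cmod y \<le> cmod z")
  case True
  then have "(log_cutoff r n y - log_cutoff r n z)\<^sup>2 \<le> (cmod (z - y))\<^sup>2 * cutoff_weight r n y / (real n * ln 2)\<^sup>2"
    by (rule log_cutoff_diff_le)
  also have "\<dots> \<le> (cmod (z - y))\<^sup>2 * (cutoff_weight r n y + cutoff_weight r n z) / (real n * ln 2)\<^sup>2"
    by (intro divide_right_mono mult_left_mono) (simp_all add: cutoff_weight_nonneg)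
  finally show ?thesis .
next
  case False
  then have "(log_cutoff r n z - log_cutoff r n y)\<^sup>2 \<le> (cmod (y - z))\<^sup>2 * cutoff_weight r n z / (real n * ln 2)\<^sup>2"
    by (intro log_cutoff_diff_le) simp
  also have "\<dots> \<le> (cmod (y - z))\<^sup>2 * (cutoff_weight r n y + cutoff_weight r n z) / (real n * ln 2)\<^sup>2"
    by (intro divide_right_mono mult_left_mono) (simp_all add: cutoff_weight_nonneg)
  finally show ?thesis
    by (simp add: norm_minus_commute power2_commute)
qed

text \<open>The summand of the smallest dyadic disc containing \<open>z\<close> already dominates
  the weight, because the radius of that disc is at most \<open>2 * max r (cmod z)\<close>.\<close>

lemma cutoff_weight_le_dyadic:
  "cutoff_weight r n z \<le> (\<Sum>k\<le>n. 4 / (r * 2 ^ k)\<^sup>2 * indicator (cball 0 (r * 2 ^ k)) z)"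
proof (cases "z \<in> cball 0 (r * 2 ^ n)")
  case False
  then show ?thesis
    using r by (simp add: cutoff_weight_def sum_nonneg)
next
  case True
  define k where "k = (LEAST k. cmod z \<le> r * 2 ^ k)"
  have k: "cmod z \<le> r * 2 ^ k" "k \<le> n"
    using True unfolding k_def by (auto intro: LeastI Least_le)
  \<comment> \<open>By minimality of \<open>k\<close>, either the disc has radius \<open>r\<close>
    or \<open>z\<close> lies outside the disc of half its radius.\<close>
  have half: "r * 2 ^ k / 2 \<le> max r (cmod z)"
  proof (cases k)
    case 0
    then show ?thesis using r by simp
  next
    case (Suc l)
    then have "\<not> cmod z \<le> r * 2 ^ l"
      unfolding k_def by (metis k_def lessI not_less_Least)
    with Suc show ?thesis
      by simp
  qed
  have "(r * 2 ^ k / 2)\<^sup>2 \<le> (max r (cmod z))\<^sup>2"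
    using half r by (intro power_mono) simp_all
  then have "1 / (max r (cmod z))\<^sup>2 \<le> 1 / (r * 2 ^ k / 2)\<^sup>2"
    using r by (intro divide_left_mono mult_pos_pos) simp_all
  then have "cutoff_weight r n z \<le> 4 / (r * 2 ^ k)\<^sup>2 * indicator (cball 0 (r * 2 ^ k)) z"
    using k True by (simp add: cutoff_weight_def power_divide)
  also have "\<dots> \<le> (\<Sum>k\<le>n. 4 / (r * 2 ^ k)\<^sup>2 * indicator (cball 0 (r * 2 ^ k)) z)"
    using k(2) by (intro member_le_sum) simp_all
  finally show ?thesis .
qed

lemma borel_measurable_cutoff_weight [measurable]: "cutoff_weight r n \<in> borel_measurable borel"
proof -
  have [measurable]: "cball (0::complex) (r * 2 ^ n) \<in> sets borel"
    by simp
  have [measurable]: "(\<lambda>z::complex. max r (cmod z)) \<in> borel_measurable borel"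
    by (intro borel_measurable_continuous_onI continuous_intros)
  show ?thesis
    unfolding cutoff_weight_def by measurable
qed

text \<open>Area scales as the square of the radius in the plane, so each of the
  \<open>n + 1\<close> dyadic summands contributes the same amount \<open>4 * pi\<close>.\<close>

lemma nn_integral_cutoff_weight_le:
  "(\<integral>\<^sup>+z. ennreal (cutoff_weight r n z) \<partial>lborel) \<le> ennreal (4 * pi * (real n + 1))"
proof -
  have "(\<integral>\<^sup>+z. ennreal (cutoff_weight r n z) \<partial>lborel) \<le>
      (\<integral>\<^sup>+z. (\<Sum>k\<le>n. ennreal (4 / (r * 2 ^ k)\<^sup>2) * indicator (cball (0::complex) (r * 2 ^ k)) z) \<partial>lborel)"
  proof (intro nn_integral_mono)
    fix z
    have "ennreal (cutoff_weight r n z) \<le> ennreal (\<Sum>k\<le>n. 4 / (r * 2 ^ k)\<^sup>2 * indicator (cball 0 (r * 2 ^ k)) z)"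
      by (intro ennreal_leI cutoff_weight_le_dyadic)
    also have "\<dots> = (\<Sum>k\<le>n. ennreal (4 / (r * 2 ^ k)\<^sup>2 * indicator (cball 0 (r * 2 ^ k)) z))"
      by (rule sum_ennreal[symmetric]) simp
    also have "\<dots> = (\<Sum>k\<le>n. ennreal (4 / (r * 2 ^ k)\<^sup>2) * indicator (cball 0 (r * 2 ^ k)) z)"
      by (intro sum.cong refl) (simp split: split_indicator)
    finally show "ennreal (cutoff_weight r n z) \<le>
        (\<Sum>k\<le>n. ennreal (4 / (r * 2 ^ k)\<^sup>2) * indicator (cball 0 (r * 2 ^ k)) z)" .
  qed
  also have "\<dots> = (\<Sum>k\<le>n. ennreal (4 / (r * 2 ^ k)\<^sup>2) * emeasure lborel (cball (0::complex) (r * 2 ^ k)))"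
  proof -
    have [measurable]: "cball (0::complex) (r * 2 ^ k) \<in> sets borel" for k
      by simp
    show ?thesis
      by (subst nn_integral_sum, measurable)
         (intro sum.cong refl nn_integral_cmult_indicator, simp)
  qed
  also have "\<dots> = (\<Sum>k\<le>n. ennreal (4 * pi))"
  proof (intro sum.cong refl)
    fix k
    have "emeasure lborel (cball (0::complex) (r * 2 ^ k)) = ennreal (pi * (r * 2 ^ k)\<^sup>2)"
      using r by (subst emeasure_cball) (simp_all add: unit_ball_vol_2)
    then show "ennreal (4 / (r * 2 ^ k)\<^sup>2) * emeasure lborel (cball (0::complex) (r * 2 ^ k)) = ennreal (4 * pi)"
      using r by (simp flip: ennreal_mult')
  qed
  also have "\<dots> = ennreal (4 * pi * (real n + 1))"
    by (subst sum_ennreal) (simp_all add: mult_ac)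
  finally show ?thesis .
qed

text \<open>The weight has integral of order \<open>n\<close>, the Gaussian moment is bounded, and
  the normalisation divides by the square of \<open>n * ln 2\<close>; the energy therefore decays
  like \<open>1 / n\<close>.\<close>

lemma log_cutoff_energy_le:
  "(\<integral>\<^sup>+y. (\<integral>\<^sup>+z. ennreal ((log_cutoff r n y - log_cutoff r n z)\<^sup>2 * exp (- (cmod (z - y))\<^sup>2) / pi\<^sup>2) \<partial>lborel) \<partial>lborel)
     \<le> ennreal (32 / ((ln 2)\<^sup>2 * real n))"
proof -
  define q where "q = 1 / ((real n * ln 2)\<^sup>2 * pi\<^sup>2)"
  define g where "g z = (cmod z)\<^sup>2 * exp (- (cmod z)\<^sup>2)" for z
  let ?w = "cutoff_weight r n"
  have [measurable]: "g \<in> borel_measurable borel"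
    unfolding g_def by measurable
  have g: "(\<integral>\<^sup>+z. ennreal (g (z - y)) \<partial>lborel) \<le> ennreal (2 * pi)" for y
    unfolding g_def by (rule nn_integral_gaussian_moment_le)
  have g_nonneg: "g z \<ge> 0" for z
    by (simp add: g_def)
  have q: "q \<ge> 0"
    by (simp add: q_def)
  have left: "(\<integral>\<^sup>+y. (\<integral>\<^sup>+z. ennreal (?w y) * ennreal (g (z - y)) \<partial>lborel) \<partial>lborel) \<le>
      ennreal (4 * pi * (real n + 1)) * ennreal (2 * pi)"
  proof -
    have "(\<integral>\<^sup>+y. (\<integral>\<^sup>+z. ennreal (?w y) * ennreal (g (z - y)) \<partial>lborel) \<partial>lborel) =
        (\<integral>\<^sup>+y. ennreal (?w y) * (\<integral>\<^sup>+z. ennreal (g (z - y)) \<partial>lborel) \<partial>lborel)"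
      by (simp add: nn_integral_cmult)
    also have "\<dots> \<le> (\<integral>\<^sup>+y. ennreal (?w y) * ennreal (2 * pi) \<partial>lborel)"
      by (intro nn_integral_mono mult_left_mono g) simp
    also have "\<dots> = (\<integral>\<^sup>+y. ennreal (?w y) \<partial>lborel) * ennreal (2 * pi)"
      by (simp add: nn_integral_multc)
    also have "\<dots> \<le> ennreal (4 * pi * (real n + 1)) * ennreal (2 * pi)"
      by (intro mult_right_mono nn_integral_cutoff_weight_le) simp
    finally show ?thesis .
  qed
  have right: "(\<integral>\<^sup>+y. (\<integral>\<^sup>+z. ennreal (?w z) * ennreal (g (z - y)) \<partial>lborel) \<partial>lborel) \<le>
      ennreal (4 * pi * (real n + 1)) * ennreal (2 * pi)"
  proof -
    have "(\<integral>\<^sup>+y. (\<integral>\<^sup>+z. ennreal (?w z) * ennreal (g (z - y)) \<partial>lborel) \<partial>lborel) =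
        (\<integral>\<^sup>+z. (\<integral>\<^sup>+y. ennreal (?w z) * ennreal (g (z - y)) \<partial>lborel) \<partial>lborel)"
      by (rule lborel_pair.Fubini') measurable
    also have "\<dots> = (\<integral>\<^sup>+z. (\<integral>\<^sup>+y. ennreal (?w z) * ennreal (g (y - z)) \<partial>lborel) \<partial>lborel)"
      by (simp add: g_def norm_minus_commute)
    finally show ?thesis
      using left by simp
  qed
  have "(\<integral>\<^sup>+y. (\<integral>\<^sup>+z. ennreal ((log_cutoff r n y - log_cutoff r n z)\<^sup>2 * exp (- (cmod (z - y))\<^sup>2) / pi\<^sup>2) \<partial>lborel) \<partial>lborel)
      \<le> (\<integral>\<^sup>+y. (\<integral>\<^sup>+z. ennreal q * (ennreal (?w y) * ennreal (g (z - y)) + ennreal (?w z) * ennreal (g (z - y))) \<partial>lborel) \<partial>lborel)"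
  proof (intro nn_integral_mono)
    fix y z
    have "(log_cutoff r n y - log_cutoff r n z)\<^sup>2 * exp (- (cmod (z - y))\<^sup>2) / pi\<^sup>2 \<le>
        (cmod (z - y))\<^sup>2 * (?w y + ?w z) / (real n * ln 2)\<^sup>2 * exp (- (cmod (z - y))\<^sup>2) / pi\<^sup>2"
      by (intro divide_right_mono mult_right_mono log_cutoff_diff_le_symmetric) simp_all
    also have "\<dots> = q * (?w y * g (z - y) + ?w z * g (z - y))"
      unfolding q_def g_def by (simp add: algebra_simps add_divide_distrib)
    finally have "ennreal ((log_cutoff r n y - log_cutoff r n z)\<^sup>2 * exp (- (cmod (z - y))\<^sup>2) / pi\<^sup>2) \<le>
        ennreal (q * (?w y * g (z - y) + ?w z * g (z - y)))"
      by (rule ennreal_leI)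
    also have "\<dots> = ennreal q * (ennreal (?w y) * ennreal (g (z - y)) + ennreal (?w z) * ennreal (g (z - y)))"
      using q g_nonneg cutoff_weight_nonneg by (simp add: ennreal_mult')
    finally show "ennreal ((log_cutoff r n y - log_cutoff r n z)\<^sup>2 * exp (- (cmod (z - y))\<^sup>2) / pi\<^sup>2) \<le>
        ennreal q * (ennreal (?w y) * ennreal (g (z - y)) + ennreal (?w z) * ennreal (g (z - y)))" .
  qed
  also have "\<dots> = ennreal q * ((\<integral>\<^sup>+y. (\<integral>\<^sup>+z. ennreal (?w y) * ennreal (g (z - y)) \<partial>lborel) \<partial>lborel) +
      (\<integral>\<^sup>+y. (\<integral>\<^sup>+z. ennreal (?w z) * ennreal (g (z - y)) \<partial>lborel) \<partial>lborel))"
    by (simp add: nn_integral_cmult nn_integral_add)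
  also have "\<dots> \<le> ennreal q * (ennreal (4 * pi * (real n + 1)) * ennreal (2 * pi) +
      ennreal (4 * pi * (real n + 1)) * ennreal (2 * pi))"
    by (intro mult_left_mono add_mono left right) simp
  also have "\<dots> = ennreal (q * (4 * pi * (real n + 1) * (2 * pi) + 4 * pi * (real n + 1) * (2 * pi)))"
    using q by (simp only: ennreal_mult ennreal_plus mult_nonneg_nonneg add_nonneg_nonneg pi_ge_zero
        of_nat_0_le_iff zero_le_one zero_le_numeral)
  also have "\<dots> \<le> ennreal (32 / ((ln 2)\<^sup>2 * real n))"
  proof (rule ennreal_leI)
    have "q * (4 * pi * (real n + 1) * (2 * pi) + 4 * pi * (real n + 1) * (2 * pi)) =
        16 * (real n + 1) / ((ln 2)\<^sup>2 * real n * real n)"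
      unfolding q_def using n by (simp add: power2_eq_square field_simps)
    \<comment> \<open>Here \<open>n + 1 \<le> 2 * n\<close>, since \<open>n\<close> is
      positive.\<close>
    also have "\<dots> \<le> 16 * (2 * real n) / ((ln 2)\<^sup>2 * real n * real n)"
      using n by (intro divide_right_mono) simp_all
    also have "\<dots> = 32 / ((ln 2)\<^sup>2 * real n)"
      using n by simp
    finally show "q * (4 * pi * (real n + 1) * (2 * pi) + 4 * pi * (real n + 1) * (2 * pi)) \<le> 32 / ((ln 2)\<^sup>2 * real n)" .
  qed
  finally show ?thesis .
qed

end

section \<open>Rigidity of the number of points\<close>

text \<open>The sum of the squares has finite integral by monotone convergence, so it is finite
  almost everywhere and its terms tend to 0.\<close>

lemma AE_LIMSEQ_zero_if_square_integrals_summable: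
  fixes X :: "nat \<Rightarrow> 'a \<Rightarrow> real"
  assumes [measurable]: "\<And>j. X j \<in> borel_measurable M"
    and le: "\<And>j. (\<integral>\<^sup>+\<omega>. ennreal ((X j \<omega>)\<^sup>2) \<partial>M) \<le> ennreal (b j)"
    and b: "summable b" "\<And>j. 0 \<le> b j"
  shows "AE \<omega> in M. (\<lambda>j. X j \<omega>) \<longlonglongrightarrow> 0"
proof -
  have "(\<integral>\<^sup>+\<omega>. (\<Sum>j. ennreal ((X j \<omega>)\<^sup>2)) \<partial>M) = (\<Sum>j. \<integral>\<^sup>+\<omega>. ennreal ((X j \<omega>)\<^sup>2) \<partial>M)"
    by (rule nn_integral_suminf) measurable
  also have "\<dots> \<le> (\<Sum>j. ennreal (b j))"
    by (intro suminf_le le) auto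
  also have "\<dots> < \<infinity>"
    using b by (simp add: suminf_ennreal2)
  finally have "AE \<omega> in M. (\<Sum>j. ennreal ((X j \<omega>)\<^sup>2)) \<noteq> \<infinity>"
    by (intro nn_integral_noteq_infinite) auto
  then show ?thesis
  proof eventually_elim
    case (elim \<omega>)
    then have "summable (\<lambda>j. (X j \<omega>)\<^sup>2)"
      by (intro summable_suminf_not_top) auto
    then have "(\<lambda>j. (X j \<omega>)\<^sup>2) \<longlonglongrightarrow> 0"
      by (rule summable_LIMSEQ_zero)
    then have "(\<lambda>j. sqrt ((X j \<omega>)\<^sup>2)) \<longlonglongrightarrow> sqrt 0"
      by (rule tendsto_real_sqrt)
    then show ?case
      by (simp add: tendsto_rabs_zero_iff)
  qed
qed

theorem theorem1p1:
  fixes M :: "'a measure" and G :: "'a \<Rightarrow> complex set" and D :: "complex set"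
  assumes "infinite_ginibre_ensemble M G"
    and "open D" and "bounded D"
  shows "\<exists>N :: complex set \<Rightarrow> nat.
           N \<in> configuration_space (- D) \<rightarrow>\<^sub>M count_space UNIV \<and>
           (AE \<omega> in M. card (G \<omega> \<inter> D) = N (G \<omega> \<inter> - D))"
proof -
  obtain r where r: "r > 0" "D \<subseteq> cball 0 r"
    using assms(3) by (auto simp: bounded_pos subset_iff)
  \<comment> \<open>The exponentially growing parameter \<open>2 ^ j\<close> turns the energy bound
    of order \<open>1 / n\<close> into a summable geometric sequence.\<close>
  define \<phi> where "\<phi> j = log_cutoff r (2 ^ j)" for j :: nat
  define R where "R j = r * 2 ^ (2 ^ j)" for j :: nat
  have rR: "r \<le> R j" for j
    using r(1) by (simp add: R_def)
  have \<phi>_cont: "continuous_on UNIV (\<phi> j)" for j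
    unfolding \<phi>_def using r(1) by (intro continuous_on_log_cutoff) simp_all
  have \<phi>_bounds: "0 \<le> \<phi> j z" "\<phi> j z \<le> 1" for j z
    unfolding \<phi>_def using r(1) by (intro log_cutoff_bounds; simp)+
  have \<phi>_supp: "\<phi> j z = 0" if "z \<notin> cball 0 (R j)" for j z
    unfolding \<phi>_def using r(1) that by (intro log_cutoff_outside) (simp_all add: R_def)
  have \<phi>_D: "\<phi> j z = 1" if "z \<in> D" for j z
    unfolding \<phi>_def using r that by (intro log_cutoff_inside) auto
  have \<phi>_test: "\<phi> j \<in> test_functions UNIV" for j
    by (rule test_functions_UNIV[where R = "R j"], rule \<phi>_cont, rule \<phi>_supp)
  define F where "F j \<xi> = (\<integral>x. \<phi> j x \<partial>count_space \<xi>)" for j \<xi>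
  \<comment> \<open>Openness of \<open>D\<close> enters here: its complement is closed, so the
    cutoffs restrict to test functions there.\<close>
  have F_meas [measurable]: "F j \<in> borel_measurable (configuration_space (- D))" for j
    unfolding F_def
    by (intro borel_measurable_linear_statistic test_functions_subset[OF \<phi>_test] closed_Compl assms(2))
  have "\<exists>c. 2 * (\<integral>\<^sup>+\<omega>. ennreal ((F j (G \<omega>) - c)\<^sup>2) \<partial>M) \<le> ennreal (32 / ((ln 2)\<^sup>2 * real (2 ^ j)))" for j
  proof -
    have "\<exists>c. 2 * (\<integral>\<^sup>+\<omega>. ennreal ((F j (G \<omega>) - c)\<^sup>2) \<partial>M) =
      (\<integral>\<^sup>+y. (\<integral>\<^sup>+z. ennreal ((\<phi> j y - \<phi> j z)\<^sup>2 * exp (- (cmod (z - y))\<^sup>2) / pi\<^sup>2) \<partial>lborel) \<partial>lborel)"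
      unfolding F_def
      by (rule variance_linear_statistic[where R = "R j"], rule assms(1), rule \<phi>_cont,
          rule \<phi>_bounds, rule \<phi>_bounds, rule \<phi>_supp)
    moreover have "(\<integral>\<^sup>+y. (\<integral>\<^sup>+z. ennreal ((\<phi> j y - \<phi> j z)\<^sup>2 * exp (- (cmod (z - y))\<^sup>2) / pi\<^sup>2) \<partial>lborel) \<partial>lborel)
      \<le> ennreal (32 / ((ln 2)\<^sup>2 * real (2 ^ j)))"
      unfolding \<phi>_def using r(1) by (rule log_cutoff_energy_le) simp
    ultimately show ?thesis
      by metis
  qed
  \<comment> \<open>The centring constants do not depend on \<open>\<omega>\<close>, so they may
    enter the definition of \<open>N\<close>.\<close>
  then obtain c where c: "\<And>j. 2 * (\<integral>\<^sup>+\<omega>. ennreal ((F j (G \<omega>) - c j)\<^sup>2) \<partial>M) \<le> ennreal (32 / ((ln 2)\<^sup>2 * real (2 ^ j)))"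
    by metis
  have conv: "AE \<omega> in M. (\<lambda>j. F j (G \<omega>) - c j) \<longlonglongrightarrow> 0"
  proof (rule AE_LIMSEQ_zero_if_square_integrals_summable)
    show "(\<lambda>\<omega>. F j (G \<omega>) - c j) \<in> borel_measurable M" for j
      unfolding F_def
      by (intro borel_measurable_diff borel_measurable_const
          measurable_compose[OF infinite_ginibre_ensembleD(2)[OF assms(1)] borel_measurable_linear_statistic[OF \<phi>_test]])
    show "(\<integral>\<^sup>+\<omega>. ennreal ((F j (G \<omega>) - c j)\<^sup>2) \<partial>M) \<le> ennreal (32 / (ln 2)\<^sup>2 * (1 / 2) ^ j)" for j
    proof -
      have "(\<integral>\<^sup>+\<omega>. ennreal ((F j (G \<omega>) - c j)\<^sup>2) \<partial>M) \<le> 2 * (\<integral>\<^sup>+\<omega>. ennreal ((F j (G \<omega>) - c j)\<^sup>2) \<partial>M)"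
        by (simp add: mult_2)
      also note c
      finally show ?thesis
        by (simp add: power_divide)
    qed
    show "summable (\<lambda>j. 32 / (ln 2)\<^sup>2 * (1 / 2 :: real) ^ j)"
      by (intro summable_mult summable_geometric) simp
  qed simp
  \<comment> \<open>Rounding to the nearest integer gives a measurable natural-valued function on
    all configurations, including those where the sequence diverges and \<open>lim\<close> is an
    unspecified value.\<close>
  define N where "N \<xi> = nat \<lfloor>lim (\<lambda>j. c j - F j \<xi>) + 1 / 2\<rfloor>" for \<xi>
  have "N \<in> configuration_space (- D) \<rightarrow>\<^sub>M count_space UNIV"
    unfolding N_def by measurable
  moreover have "AE \<omega> in M. card (G \<omega> \<inter> D) = N (G \<omega> \<inter> - D)"
    using conv AE_space
  proof eventually_elim
    case (elim \<omega>)
    have F_split: "F j (G \<omega>) = real (card (G \<omega> \<inter> D)) + F j (G \<omega> \<inter> - D)" for j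
      unfolding F_def
    proof (rule linear_statistic_split)
      show "finite (G \<omega> \<inter> cball 0 (R j))"
        using infinite_ginibre_ensembleD(3)[OF assms(1) elim(2) compact_cball] .
      show "D \<subseteq> cball 0 (R j)"
        using r(2) rR[of j] by (meson order_trans subset_cball)
    qed (use \<phi>_supp \<phi>_D in auto)
    have "(\<lambda>j. real (card (G \<omega> \<inter> D)) - (F j (G \<omega>) - c j)) \<longlonglongrightarrow> real (card (G \<omega> \<inter> D)) - 0"
      by (intro tendsto_diff tendsto_const elim(1))
    \<comment> \<open>The number of points in \<open>D\<close> cancels from
      \<open>F j (G \<omega>)\<close>, leaving a sequence determined by the outside configuration
      alone.\<close>
    then have "(\<lambda>j. c j - F j (G \<omega> \<inter> - D)) \<longlonglongrightarrow> real (card (G \<omega> \<inter> D))"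
      by (simp add: F_split)
    then have "lim (\<lambda>j. c j - F j (G \<omega> \<inter> - D)) = real (card (G \<omega> \<inter> D))"
      by (rule limI)
    then show ?case
      unfolding N_def by (simp add: floor_unique)
  qed
  ultimately show ?thesis
    by blast
qed

end
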